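(* Consider the system $y_{t+1}=\theta f(y_t)+u_t+w_{t+1}$, $t\ge 0$, under the standing assumptions in the context. For $b\in\mathbb{R}$ and $L>0$ put $S_b^L=\{x\in\mathbb{R}: |f(x)|<L|x|^b\}$, and let $\ell$ denote Lebesgue measure on $\mathbb{R}$. Suppose that (i) for some $k_1,k_2>0$, $|f(x)|\le k_1e^{k_2|x|}$ for all $x\in\mathbb{R}$; (ii) there exist two numbers $b<4$ and $L>0$ such that $$\liminf_{l\to+\infty}\frac{\ell(S_b^L\cap[-l,l])}{l}>0.$$ Then the system is globally stabilizable.
   Context: System: $y_{t+1}=\theta f(y_t)+u_t+w_{t+1}$, $t\ge0$, where $\theta\in\mathbb{R}$ is an unknown (random) parameter and $y_t,u_t,w_t\in\mathbb{R}$ are the output, input and noise. Standing assumptions: $f:\mathbb{R}\to\mathbb{R}$ is a known piecewise continuous function; the initial value $y_0$ is independent of $\theta$ and $\{w_t\}$; (A1) $\{w_t\}$ is an i.i.d. random sequence with $w_1\sim N(0,1)$; (A2) $\theta\sim N(\theta_0,P_0)$, with $P_0>0$, is independent of $\{w_t\}$. A feedback control law is a sequence $\{u_t\}_{t\ge0}$ such that $u_t$ is measurable with respect to $\mathcal{F}_t^y=\sigma\{y_i:0\le i\le t\}$ for every $t\ge0$. Definition: the system is globally stabilizable if there exists a feedback control law $\{u_t\}$ such that for any initial $y_0\in\mathbb{R}$, $\sup_{t\ge1}\frac1t\sum_{i=1}^t y_i^2<+\infty$ almost surely. *)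

theory Defs
  imports "HOL-Probability.Probability"
begin

definition piecewise_continuous :: "(real \<Rightarrow> real) \<Rightarrow> bool" where
  "piecewise_continuous f \<longleftrightarrow>
     (\<forall>a b. finite {x \<in> {a..b}. \<not> isCont f x}) \<and>
     (\<forall>x. (\<exists>c. (f \<longlongrightarrow> c) (at_left x)) \<and> (\<exists>c. (f \<longlongrightarrow> c) (at_right x)))"

(* The measurable space on \<Omega> whose sigma-algebra is the one generated by the variables in Xs. *)
definition generated :: "'a set \<Rightarrow> ('a \<Rightarrow> real) set \<Rightarrow> 'a measure" where
  "generated \<Omega> Xs = sigma \<Omega> {X -` A \<inter> \<Omega> | X A. X \<in> Xs \<and> A \<in> sets borel}"

(* A single feedback law has to serve every initial value, so it cannot be a process on the
   underlying probability space: it is given on the space of output paths p = (y_0, y_1, ...),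
   and u t is measurable with respect to the sigma-algebra generated by p_0, ..., p_t.
   Lemma feedback_law_adapted: along any output process y, the resulting control is
   measurable with respect to the sigma-algebra generated by y_0, ..., y_t. *)
definition feedback_law :: "(nat \<Rightarrow> (nat \<Rightarrow> real) \<Rightarrow> real) \<Rightarrow> bool" where
  "feedback_law u \<longleftrightarrow>
     (\<forall>t. u t \<in> borel_measurable (generated UNIV ((\<lambda>i p. p i) ` {..t})))"

definition closed_loop ::
  "'a measure \<Rightarrow> (real \<Rightarrow> real) \<Rightarrow> ('a \<Rightarrow> real) \<Rightarrow> (nat \<Rightarrow> 'a \<Rightarrow> real) \<Rightarrow>
   (nat \<Rightarrow> (nat \<Rightarrow> real) \<Rightarrow> real) \<Rightarrow> (nat \<Rightarrow> 'a \<Rightarrow> real) \<Rightarrow> bool" where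
  "closed_loop M f \<theta> w u y \<longleftrightarrow>
     (\<forall>t. \<forall>\<omega>\<in>space M.
        y (Suc t) \<omega> = \<theta> \<omega> * f (y t \<omega>) + u t (\<lambda>i. y i \<omega>) + w (Suc t) \<omega>)"

(* The initial value is any random variable, in particular any constant, which is
   independent of the pair consisting of \<theta> and the noise (w_t), t \<ge> 1. *)
definition admissible_initial ::
  "'a measure \<Rightarrow> ('a \<Rightarrow> real) \<Rightarrow> (nat \<Rightarrow> 'a \<Rightarrow> real) \<Rightarrow> ('a \<Rightarrow> real) \<Rightarrow> bool" where
  "admissible_initial M \<theta> w y0 \<longleftrightarrow>
     y0 \<in> borel_measurable M \<and>
     prob_space.indep_set M (sets (generated (space M) {y0}))
       (sets (generated (space M) (insert \<theta> (w ` {1..}))))"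

definition globally_stabilizable ::
  "'a measure \<Rightarrow> (real \<Rightarrow> real) \<Rightarrow> ('a \<Rightarrow> real) \<Rightarrow> (nat \<Rightarrow> 'a \<Rightarrow> real) \<Rightarrow> bool" where
  "globally_stabilizable M f \<theta> w \<longleftrightarrow>
     (\<exists>u. feedback_law u \<and>
        (\<forall>y. admissible_initial M \<theta> w (y 0) \<longrightarrow> closed_loop M f \<theta> w u y \<longrightarrow>
           (AE \<omega> in M. (SUP t\<in>{1..}. ereal (1 / real t * (\<Sum>i=1..t. (y i \<omega>)\<^sup>2))) < \<infinity>)))"

(* For x = 0 and b \<le> 0 the value 0 powr b = 0 is a convention; it affects one point only, hence
   not the Lebesgue measure. *)
definition growth_set :: "(real \<Rightarrow> real) \<Rightarrow> real \<Rightarrow> real \<Rightarrow> real set" where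
  "growth_set f b L = {x. \<bar>f x\<bar> < L * \<bar>x\<bar> powr b}"

lemma space_generated [simp]: "space (generated \<Omega> Xs) = \<Omega>"
  unfolding generated_def by (rule space_measure_of) auto

lemma sets_generated:
  "sets (generated \<Omega> Xs) = sigma_sets \<Omega> {X -` A \<inter> \<Omega> | X A. X \<in> Xs \<and> A \<in> sets borel}"
  unfolding generated_def by (rule sets_measure_of) auto

lemma feedback_law_adapted:
  assumes "feedback_law u"
  shows "(\<lambda>\<omega>. u t (\<lambda>i. y i \<omega>)) \<in> borel_measurable (generated \<Omega> (y ` {..t}))"
proof -
  have "(\<lambda>\<omega> i. y i \<omega>) \<in> measurable (generated \<Omega> (y ` {..t}))
          (generated UNIV ((\<lambda>i p. p i) ` {..t}))"
    unfolding generated_def[of UNIV]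
  proof (rule measurable_measure_of)
    fix B :: "(nat \<Rightarrow> real) set"
    assume "B \<in> {X -` A \<inter> UNIV | X A. X \<in> (\<lambda>i p. p i) ` {..t} \<and> A \<in> sets borel}"
    then obtain i A where "i \<le> t" "A \<in> sets borel" "B = (\<lambda>p. p i) -` A"
      by auto
    then have "(\<lambda>\<omega> i. y i \<omega>) -` B \<inter> \<Omega> \<in>
        {X -` A \<inter> \<Omega> | X A. X \<in> y ` {..t} \<and> A \<in> sets borel}"
      by auto
    then show "(\<lambda>\<omega> i. y i \<omega>) -` B \<inter> space (generated \<Omega> (y ` {..t}))
        \<in> sets (generated \<Omega> (y ` {..t}))"
      by (auto simp: sets_generated)
  qed auto
  from measurable_compose[OF this] assms show ?thesis
    unfolding feedback_law_def by blast
qed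

lemma feedback_law_cong:
  assumes "feedback_law u" and eq: "\<And>i. i \<le> t \<Longrightarrow> p i = q i"
  shows "u t p = u t q"
proof -
  have inv: "p \<in> B \<longleftrightarrow> q \<in> B" if "B \<in> sets (generated UNIV ((\<lambda>i p. p i) ` {..t}))" for B
    using that unfolding sets_generated
    by (induction rule: sigma_sets.induct) (auto simp: eq)
  have "u t -` {u t p} \<inter> UNIV \<in> sets (generated UNIV ((\<lambda>i p. p i) ` {..t}))"
    using measurable_sets[of "u t" _ borel "{u t p}"] assms(1) borel_singleton[OF sets.empty_sets, of "u t p"]
    unfolding feedback_law_def by (metis space_generated)
  from inv[OF this] show ?thesis by simp
qed

(* Every feedback law has a closed loop from every initial value, so the quantification over y in
   globally_stabilizable is not vacuous. *)
lemma closed_loop_exists: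
  assumes "feedback_law u"
  shows "\<exists>y. y 0 = y0 \<and> closed_loop M f \<theta> w u y"
proof -
  define P where "P \<omega> = rec_nat (\<lambda>_. y0 \<omega>)
    (\<lambda>t p. p(Suc t := \<theta> \<omega> * f (p t) + u t p + w (Suc t) \<omega>))" for \<omega>
  have P_Suc: "P \<omega> (Suc t) =
      (P \<omega> t)(Suc t := \<theta> \<omega> * f (P \<omega> t t) + u t (P \<omega> t) + w (Suc t) \<omega>)" for \<omega> t
    by (simp add: P_def)
  have stable: "P \<omega> t i = P \<omega> i i" if "i \<le> t" for \<omega> t i
    using that by (induction t) (auto simp: P_Suc le_Suc_eq)
  have "u t (P \<omega> t) = u t (\<lambda>i. P \<omega> i i)" for \<omega> t
    by (rule feedback_law_cong[OF assms]) (rule stable)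
  then have "closed_loop M f \<theta> w u (\<lambda>t \<omega>. P \<omega> t t)"
    unfolding closed_loop_def by (simp add: P_Suc)
  moreover have "(\<lambda>\<omega>. P \<omega> 0 0) = y0"
    by (simp add: P_def)
  ultimately show ?thesis by (intro exI[of _ "\<lambda>t \<omega>. P \<omega> t t"]) simp
qed

end

theory Submission
  imports Defs
begin

text \<open>
  The control is the self-tuning regulator \<open>u\<^sub>t = - m\<^sub>t f(y\<^sub>t)\<close>, where \<open>m\<^sub>t\<close> is the posterior mean of
  \<open>\<theta>\<close>. Completing squares shows that given \<open>y\<^sub>0, \<dots>, y\<^sub>t\<close> the parameter has law \<open>N(m\<^sub>t, 1/q\<^sub>t)\<close> with
  \<open>q\<^sub>t = 1/P\<^sub>0 + \<Sum>\<^bsub>i<t\<^esub> f(y\<^sub>i)\<^sup>2\<close>, so that \<open>(y\<^sub>t, q\<^sub>t)\<close> is a Markov chain in which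
  \<open>y\<^bsub>t+1\<^esub>\<close> has law \<open>N(0, 1 + f(y\<^sub>t)\<^sup>2/q\<^sub>t)\<close>.

  By a zero-one law it suffices that from every state the averages stay bounded with a probability
  bounded away from zero. If \<open>q\<close> is large and \<open>f(y)\<^sup>2 \<le> q\<close>, a supermartingale argument bounds the
  probability of ever leaving this regime: the exponential growth bound controls the fourth moments
  of \<open>f\<close>, and \<open>1/q\<close> decreases by a multiple of \<open>1/q\<^sup>2\<close> at each visit to an interval where \<open>f\<close> is bounded
  away from zero. From a state with bounded variance, finitely many such visits make \<open>q\<close> large. From
  an arbitrary state, the chain hits the set \<open>|f(x)| < L |x|\<^sup>b\<close> with probability bounded below; along
  such hits \<open>ln q\<^bsub>t+2\<^esub> \<le> b (ln q\<^bsub>t+1\<^esub> - ln q\<^sub>t)\<close> up to a constant, and since \<open>z\<^sup>2 - b z + b\<close> has no real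
  root for \<open>0 < b < 4\<close>, the variance becomes bounded after a fixed number of steps.
\<close>

section \<open>Gaussian transitions on the path space\<close>

abbreviation path_space :: "(nat \<Rightarrow> real) measure" where
  "path_space \<equiv> PiM UNIV (\<lambda>_. borel)"

text \<open>Pointwise stand-in for measurability with respect to the first \<open>t + 1\<close>
  coordinates: a measurable function with this property does not change when the later coordinates
  are frozen at constants, so it is a measurable function of the first ones.\<close>

definition adapted :: "nat \<Rightarrow> ((nat \<Rightarrow> real) \<Rightarrow> 'b) \<Rightarrow> bool" where
  "adapted t g \<longleftrightarrow> (\<forall>p p'. (\<forall>i\<le>t. p i = p' i) \<longrightarrow> g p = g p')"

lemma adaptedD: "adapted t g \<Longrightarrow> (\<And>i. i \<le> t \<Longrightarrow> p i = p' i) \<Longrightarrow> g p = g p'"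
  unfolding adapted_def by blast

lemma adapted_mono: "adapted s g \<Longrightarrow> s \<le> t \<Longrightarrow> adapted t g"
  unfolding adapted_def by (meson le_trans)

lemma adapted_upd: "adapted t g \<Longrightarrow> t < s \<Longrightarrow> g (p(s := b)) = g p"
  by (erule adaptedD) auto

lemma adapted_indicator:
  assumes "adapted t (\<lambda>p. p \<in> A)"
  shows "adapted t (indicator A)"
  unfolding adapted_def
proof (intro allI impI)
  fix p p' :: "nat \<Rightarrow> real" assume "\<forall>i\<le>t. p i = p' i"
  then have "p \<in> A \<longleftrightarrow> p' \<in> A" using adaptedD[OF assms, of p p'] by blast
  then show "indicator A p = indicator A p'" by (simp add: indicator_def)
qed

lemma measurable_path_upd [measurable (raw)]:
  assumes "g \<in> measurable N path_space" "h \<in> borel_measurable N"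
  shows "(\<lambda>x. (g x)(s := h x)) \<in> measurable N path_space"
  by (rule measurable_fun_upd[where J=UNIV]) (use assms in auto)

text \<open>The posterior precision of the parameter at time \<open>t\<close> when \<open>q0\<close>
  is the prior precision. The sum stops before \<open>t\<close> because \<open>f (p t)\<close>
  multiplies the parameter only in the output at time \<open>t + 1\<close>.\<close>

definition info :: "(real \<Rightarrow> real) \<Rightarrow> real \<Rightarrow> nat \<Rightarrow> (nat \<Rightarrow> real) \<Rightarrow> real" where
  "info f q0 t p = q0 + (\<Sum>i<t. (f (p i))\<^sup>2)"

lemma info_Suc: "info f q0 (Suc t) p = info f q0 t p + (f (p t))\<^sup>2"
  by (simp add: info_def)

lemma info_ge: "q0 \<le> info f q0 t p"
  by (simp add: info_def sum_nonneg)

lemma info_cong: "(\<And>i. i < t \<Longrightarrow> p i = p' i) \<Longrightarrow> info f q0 t p = info f q0 t p'"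
  by (simp add: info_def)

lemma info_upd [simp]: "t \<le> s \<Longrightarrow> info f q0 t (p(s := b)) = info f q0 t p"
  by (rule info_cong) auto

lemma adapted_state: "adapted t (\<lambda>p. H (p t) (info f q0 t p))"
  unfolding adapted_def
proof (intro allI impI)
  fix p p' :: "nat \<Rightarrow> real" assume "\<forall>i\<le>t. p i = p' i"
  then show "H (p t) (info f q0 t p) = H (p' t) (info f q0 t p')"
    using info_cong[of t p p' f q0] by simp
qed

lemma measurable_info [measurable]:
  assumes [measurable]: "f \<in> borel_measurable borel"
  shows "info f q0 t \<in> borel_measurable path_space"
  unfolding info_def[abs_def] by measurable

section \<open>Centred Gaussian laws and the predictive variance\<close>

definition gauss :: "real \<Rightarrow> real measure" where
  "gauss \<sigma> = density lborel (normal_density 0 \<sigma>)"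

lemma sets_gauss [simp, measurable_cong]: "sets (gauss \<sigma>) = sets borel"
  by (simp add: gauss_def)

lemma space_gauss [simp]: "space (gauss \<sigma>) = UNIV"
  by (simp add: gauss_def)

lemma prob_space_gauss: "0 < \<sigma> \<Longrightarrow> prob_space (gauss \<sigma>)"
  unfolding gauss_def by (rule prob_space_normal_density)

lemma nn_integral_gauss:
  assumes [measurable]: "g \<in> borel_measurable borel"
  shows "(\<integral>\<^sup>+b. g b \<partial>gauss \<sigma>) = (\<integral>\<^sup>+b. ennreal (normal_density 0 \<sigma> b) * g b \<partial>lborel)"
  unfolding gauss_def by (subst nn_integral_density) auto

text \<open>Standard deviation of the next output: unit noise variance plus the posterior variance
  \<open>1 / q\<close> of the parameter, amplified by \<open>(f y)^2\<close>.\<close>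

definition scale :: "(real \<Rightarrow> real) \<Rightarrow> real \<Rightarrow> real \<Rightarrow> real" where
  "scale f y q = sqrt (1 + (f y)\<^sup>2 / q)"

lemma scale_ge1: "0 \<le> q \<Longrightarrow> 1 \<le> scale f y q"
  by (simp add: scale_def)

lemma scale_square: "0 \<le> q \<Longrightarrow> (scale f y q)\<^sup>2 = 1 + (f y)\<^sup>2 / q"
  by (simp add: scale_def)

text \<open>For variance at most 2, \<open>- b^2 / (2 \<sigma>^2) + b^2 / 8 \<le> - b^2 / 8\<close>,
  which is the exponent of the normal density with standard deviation 2. The factor 2 is the
  quotient of the normalising constants for standard deviations 1 and 2.\<close>

lemma gauss_exp_square_le:
  assumes "1 \<le> \<sigma>" "\<sigma>\<^sup>2 \<le> 2"
  shows "(\<integral>\<^sup>+b. ennreal (exp (b\<^sup>2 / 8)) \<partial>gauss \<sigma>) \<le> 2"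
proof -
  have le: "normal_density 0 \<sigma> b * exp (b\<^sup>2 / 8) \<le> 2 * normal_density 0 2 b" for b
  proof -
    have "1 / sqrt (2 * pi * \<sigma>\<^sup>2) \<le> 1 / sqrt (2 * pi)"
      using assms by (intro divide_left_mono real_sqrt_le_mono mult_pos_pos) auto
    moreover have "exp (- b\<^sup>2 / (2 * \<sigma>\<^sup>2)) * exp (b\<^sup>2 / 8) \<le> exp (- b\<^sup>2 / 8)"
    proof -
      have "b\<^sup>2 / 4 \<le> b\<^sup>2 / (2 * \<sigma>\<^sup>2)"
        using assms by (intro divide_left_mono) auto
      then show ?thesis by (simp flip: exp_add)
    qed
    ultimately have "(1 / sqrt (2 * pi * \<sigma>\<^sup>2)) * (exp (- b\<^sup>2 / (2 * \<sigma>\<^sup>2)) * exp (b\<^sup>2 / 8))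
        \<le> (1 / sqrt (2 * pi)) * exp (- b\<^sup>2 / 8)"
      by (intro mult_mono) auto
    also have "\<dots> = 2 * normal_density 0 2 b"
    proof -
      have "sqrt (2 * pi * 2\<^sup>2) = 2 * sqrt (2 * pi)"
        using real_sqrt_mult[of "2\<^sup>2" "2 * pi"] by (simp add: mult.commute)
      then show ?thesis by (simp add: normal_density_def)
    qed
    finally show ?thesis by (simp add: normal_density_def mult.assoc)
  qed
  have "(\<integral>\<^sup>+b. ennreal (exp (b\<^sup>2 / 8)) \<partial>gauss \<sigma>)
      = (\<integral>\<^sup>+b. ennreal (normal_density 0 \<sigma> b * exp (b\<^sup>2 / 8)) \<partial>lborel)"
    by (subst nn_integral_gauss) (auto simp: ennreal_mult)
  also have "\<dots> \<le> (\<integral>\<^sup>+b. 2 * ennreal (normal_density 0 2 b) \<partial>lborel)"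
    by (intro nn_integral_mono) (use le in \<open>simp add: ennreal_mult'[symmetric] flip: ennreal_numeral\<close>)
  also have "\<dots> = 2 * emeasure (gauss 2) UNIV"
    by (subst nn_integral_cmult) (auto simp: gauss_def emeasure_density)
  also have "\<dots> = 2"
    using prob_space.emeasure_space_1[OF prob_space_gauss[of 2]] by simp
  finally show ?thesis .
qed

definition bounded_average :: "(nat \<Rightarrow> real) set" where
  "bounded_average = {p. \<exists>K. \<forall>t\<ge>1. (\<Sum>i=1..t. (p i)\<^sup>2) \<le> K * real t}"

text \<open>Restricting the bound to natural numbers turns the existential into a countable union,
  from which measurability follows.\<close>

lemma bounded_average_nat:
  "bounded_average = (\<Union>K::nat. {p. \<forall>t\<ge>1. (\<Sum>i=1..t. (p i)\<^sup>2) \<le> real K * real t})"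
proof -
  have "\<exists>K'::nat. \<forall>t\<ge>1. (\<Sum>i=1..t. (p i)\<^sup>2) \<le> real K' * real t"
    if "\<forall>t\<ge>1. (\<Sum>i=1..t. (p i)\<^sup>2) \<le> K * real t" for p :: "nat \<Rightarrow> real" and K
  proof -
    obtain K' :: nat where "K \<le> real K'" using real_arch_simple by blast
    then show ?thesis
      using that by (intro exI[of _ K'] allI impI) (auto intro: order_trans[OF _ mult_right_mono])
  qed
  then show ?thesis unfolding bounded_average_def by blast
qed

lemma sets_bounded_average [measurable]: "bounded_average \<in> sets path_space"
proof -
  have "{p \<in> space path_space. \<forall>t\<ge>1. (\<Sum>i=1..t. (p i)\<^sup>2) \<le> real K * real t} \<in> sets path_space"
    for K :: nat
    by measurable
  then show ?thesis
    unfolding bounded_average_nat by (auto simp: space_PiM)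
qed

section \<open>States from which the averages stay bounded\<close>

text \<open>\<open>D\<close> is the law of the output path. The assumption \<open>step\<close> is
  its Markov property, integrated against nonnegative functions of the first coordinates, so that no
  conditional expectations have to be formed.\<close>

locale gaussian_path = prob_space D for D :: "(nat \<Rightarrow> real) measure" +
  fixes f :: "real \<Rightarrow> real" and q0 :: real
  assumes sets_D [measurable_cong]: "sets D = sets path_space"
    and f_measurable [measurable]: "f \<in> borel_measurable borel"
    and q0_pos: "0 < q0"
    and step: "\<And>t g. g \<in> borel_measurable path_space \<Longrightarrow> adapted (Suc t) g \<Longrightarrow>
      (\<integral>\<^sup>+p. g p \<partial>D) = (\<integral>\<^sup>+p. \<integral>\<^sup>+b. g (p(Suc t := b)) \<partial>gauss (scale f (p t) (info f q0 t p)) \<partial>D)"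
begin

lemma space_D [simp]: "space D = UNIV"
  using sets_eq_imp_space_eq[OF sets_D] by (simp add: space_PiM)

text \<open>From a state in \<open>G\<close> at any time, the average stays bounded with conditional probability
  bounded away from zero.\<close>

definition good :: "(real \<times> real) set \<Rightarrow> bool" where
  "good G \<longleftrightarrow> (\<exists>c>0. \<forall>T A. A \<in> sets D \<longrightarrow> adapted T (\<lambda>p. p \<in> A) \<longrightarrow>
     (\<forall>p\<in>A. (p T, info f q0 T p) \<in> G) \<longrightarrow> c * prob A \<le> prob (A \<inter> bounded_average))"

lemma good_mono: "good G \<Longrightarrow> G' \<subseteq> G \<Longrightarrow> good G'"
  unfolding good_def by (meson subset_iff)

text \<open>Split the event by whether the state at time \<open>T\<close> lies in \<open>G1\<close>;
  both pieces are again decided at time \<open>T\<close>, and the smaller of the two constants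
  serves.\<close>

lemma good_Un:
  assumes "good G1" "good G2" and [measurable]: "G1 \<in> sets (borel \<Otimes>\<^sub>M borel)"
  shows "good (G1 \<union> G2)"
proof -
  obtain c1 where c1: "c1 > 0" "\<And>T A. A \<in> sets D \<Longrightarrow> adapted T (\<lambda>p. p \<in> A) \<Longrightarrow>
     (\<forall>p\<in>A. (p T, info f q0 T p) \<in> G1) \<Longrightarrow> c1 * prob A \<le> prob (A \<inter> bounded_average)"
    using assms(1) unfolding good_def by blast
  obtain c2 where c2: "c2 > 0" "\<And>T A. A \<in> sets D \<Longrightarrow> adapted T (\<lambda>p. p \<in> A) \<Longrightarrow>
     (\<forall>p\<in>A. (p T, info f q0 T p) \<in> G2) \<Longrightarrow> c2 * prob A \<le> prob (A \<inter> bounded_average)"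
    using assms(2) unfolding good_def by blast
  show ?thesis unfolding good_def
  proof (intro exI[of _ "min c1 c2"] conjI allI impI)
    fix T A assume A [measurable]: "A \<in> sets D" and ad: "adapted T (\<lambda>p. p \<in> A)"
      and AG: "\<forall>p\<in>A. (p T, info f q0 T p) \<in> G1 \<union> G2"
    define B where "B = {p \<in> space D. (p T, info f q0 T p) \<in> G1}"
    have B [measurable]: "B \<in> sets D" unfolding B_def by measurable
    have adB: "adapted T (\<lambda>p. p \<in> B)"
      unfolding B_def using adapted_state[of T "\<lambda>y q. (y, q) \<in> G1"] by simp
    have ad1: "adapted T (\<lambda>p. p \<in> A \<inter> B)" "adapted T (\<lambda>p. p \<in> A - B)"
      using ad adB unfolding adapted_def Int_iff Diff_iff by meson+
    have 1: "c1 * prob (A \<inter> B) \<le> prob (A \<inter> B \<inter> bounded_average)"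
      by (rule c1(2)[OF _ ad1(1)]) (measurable, auto simp: B_def)
    have 2: "c2 * prob (A - B) \<le> prob ((A - B) \<inter> bounded_average)"
    proof (rule c2(2)[OF _ ad1(2)])
      show "\<forall>p\<in>A - B. (p T, info f q0 T p) \<in> G2" using AG by (auto simp: B_def)
    qed measurable
    have "prob A = prob (A \<inter> B) + prob (A - B)"
      by (subst finite_measure_Union[symmetric]) (auto intro!: arg_cong[where f=prob])
    moreover have "prob (A \<inter> bounded_average)
        = prob (A \<inter> B \<inter> bounded_average) + prob ((A - B) \<inter> bounded_average)"
      by (subst finite_measure_Union[symmetric]) (auto intro!: arg_cong[where f=prob])
    moreover have "min c1 c2 * prob (A \<inter> B) \<le> c1 * prob (A \<inter> B)"
      "min c1 c2 * prob (A - B) \<le> c2 * prob (A - B)"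
      by (auto intro!: mult_right_mono)
    ultimately show "min c1 c2 * prob A \<le> prob (A \<inter> bounded_average)"
      using 1 2 by (simp add: distrib_left)
  qed (use c1 c2 in auto)
qed

text \<open>Goodness of \<open>G1\<close> is applied at time \<open>T + 1\<close> to the part of the
  event whose next state lies in \<open>G1\<close>. By the Markov property this part keeps at least
  the fraction \<open>\<delta>\<close>, so the constants multiply.\<close>

lemma good_step:
  assumes "good G1" and [measurable]: "G1 \<in> sets (borel \<Otimes>\<^sub>M borel)" and "0 < \<delta>"
    and hit: "\<And>y q. (y, q) \<in> G2 \<Longrightarrow> q0 \<le> q \<Longrightarrow>
      \<delta> \<le> measure (gauss (scale f y q)) {b. (b, q + (f y)\<^sup>2) \<in> G1}"
  shows "good G2"
proof -
  obtain c where c: "c > 0" "\<And>T A. A \<in> sets D \<Longrightarrow> adapted T (\<lambda>p. p \<in> A) \<Longrightarrow>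
     (\<forall>p\<in>A. (p T, info f q0 T p) \<in> G1) \<Longrightarrow> c * prob A \<le> prob (A \<inter> bounded_average)"
    using assms(1) unfolding good_def by blast
  show ?thesis unfolding good_def
  proof (intro exI[of _ "c * \<delta>"] conjI allI impI)
    fix T A assume A [measurable]: "A \<in> sets D" and ad: "adapted T (\<lambda>p. p \<in> A)"
      and AG: "\<forall>p\<in>A. (p T, info f q0 T p) \<in> G2"
    define B where "B = {p \<in> space D. (p (Suc T), info f q0 (Suc T) p) \<in> G1}"
    have B [measurable]: "B \<in> sets D" unfolding B_def by measurable
    have adB: "adapted (Suc T) (\<lambda>p. p \<in> B)"
      unfolding B_def using adapted_state[of "Suc T" "\<lambda>y q. (y, q) \<in> G1"] by simp
    have adAB: "adapted (Suc T) (\<lambda>p. p \<in> A \<inter> B)"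
      using adB adapted_mono[OF ad, of "Suc T"] unfolding adapted_def Int_iff by (meson le_SucI order_refl)
    have "ennreal (\<delta> * prob A) = (\<integral>\<^sup>+p. ennreal \<delta> * indicator A p \<partial>D)"
      using \<open>0 < \<delta>\<close> by (simp add: nn_integral_cmult ennreal_mult emeasure_eq_measure)
    also have "\<dots> \<le> (\<integral>\<^sup>+p. \<integral>\<^sup>+b. indicator (A \<inter> B) (p(Suc T := b))
        \<partial>gauss (scale f (p T) (info f q0 T p)) \<partial>D)"
    proof (rule nn_integral_mono)
      fix p assume "p \<in> space D"
      let ?N = "gauss (scale f (p T) (info f q0 T p))"
      show "ennreal \<delta> * indicator A p \<le> (\<integral>\<^sup>+b. indicator (A \<inter> B) (p(Suc T := b)) \<partial>?N)"
      proof (cases "p \<in> A")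
        case True
        have "q0 \<le> info f q0 T p" by (rule info_ge)
        then have "0 < scale f (p T) (info f q0 T p)"
          using q0_pos scale_ge1[of "info f q0 T p" f "p T"] by linarith
        then interpret N: prob_space ?N by (rule prob_space_gauss)
        have "p(Suc T := b) \<in> A" for b
          using adapted_upd[OF ad, of "Suc T" p b] True by simp
        then have "indicator (A \<inter> B) (p(Suc T := b)) =
            (indicator {b. (b, info f q0 T p + (f (p T))\<^sup>2) \<in> G1} b :: ennreal)" for b
          by (auto simp: indicator_def B_def info_Suc)
        then have "(\<integral>\<^sup>+b. indicator (A \<inter> B) (p(Suc T := b)) \<partial>?N)
            = (\<integral>\<^sup>+b. indicator {b. (b, info f q0 T p + (f (p T))\<^sup>2) \<in> G1} b \<partial>?N)"
          by simp
        also have "\<dots> = emeasure ?N {b. (b, info f q0 T p + (f (p T))\<^sup>2) \<in> G1}"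
        proof (rule nn_integral_indicator)
          have "{b \<in> space borel. (b, info f q0 T p + (f (p T))\<^sup>2) \<in> G1} \<in> sets borel"
            by measurable
          then show "{b. (b, info f q0 T p + (f (p T))\<^sup>2) \<in> G1} \<in> sets ?N" by simp
        qed
        finally show ?thesis
          using hit[of "p T" "info f q0 T p"] AG True info_ge
          by (simp add: N.emeasure_eq_measure ennreal_leI)
      qed simp
    qed
    also have "\<dots> = (\<integral>\<^sup>+p. indicator (A \<inter> B) p \<partial>D)"
    proof (rule step[symmetric])
      show "indicator (A \<inter> B) \<in> borel_measurable path_space"
        using A B by (simp add: sets_D[symmetric])
      show "adapted (Suc T) (indicator (A \<inter> B) :: _ \<Rightarrow> ennreal)"
        using adAB by (rule adapted_indicator)
    qed
    also have "\<dots> = ennreal (prob (A \<inter> B))"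
      by (simp add: emeasure_eq_measure)
    finally have "\<delta> * prob A \<le> prob (A \<inter> B)" by simp
    then have "c * \<delta> * prob A \<le> c * prob (A \<inter> B)"
      using c(1) by (simp add: mult.assoc)
    also have "\<dots> \<le> prob (A \<inter> B \<inter> bounded_average)"
      by (rule c(2)[OF _ adAB]) (auto simp: B_def)
    also have "\<dots> \<le> prob (A \<inter> bounded_average)"
      by (rule finite_measure_mono) auto
    finally show "c * \<delta> * prob A \<le> prob (A \<inter> bounded_average)" .
  qed (use c \<open>0 < \<delta>\<close> in auto)
qed

text \<open>A maximal inequality. By \<open>fail\<close>, \<open>W < 1\<close> keeps the next
  variance at most 2, so the process \<open>Z\<close> in the proof, \<open>W\<close> plus an
  exponential of the accumulated squares, is a supermartingale until it reaches 1. It starts at most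
  at 3/4 on the event, hence stays below 1 forever with conditional probability at least
  1/4.\<close>

lemma good_supermartingale:
  fixes W :: "real \<times> real \<Rightarrow> ennreal"
  assumes W [measurable]: "W \<in> borel_measurable (borel \<Otimes>\<^sub>M borel)"
    and fail: "\<And>y q. q0 \<le> q \<Longrightarrow> q < (f y)\<^sup>2 \<Longrightarrow> 1 \<le> W (y, q)"
    and super: "\<And>y q. q0 \<le> q \<Longrightarrow> W (y, q) < 1 \<Longrightarrow>
      (\<integral>\<^sup>+b. W (b, q + (f y)\<^sup>2) \<partial>gauss (scale f y q)) \<le> W (y, q)"
  shows "good {x. W x \<le> ennreal (1/2)}"
  unfolding good_def
proof (intro exI[of _ "1/4"] conjI allI impI)
  fix T A assume A [measurable]: "A \<in> sets D" and ad: "adapted T (\<lambda>p. p \<in> A)"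
    and AG: "\<forall>p\<in>A. (p T, info f q0 T p) \<in> {x. W x \<le> ennreal (1/2)}"
  \<comment> \<open>The second summand forces the partial sums of squares to grow at most linearly as long as
    \<open>Z\<close> stays below one.\<close>
  define Z :: "nat \<Rightarrow> (nat \<Rightarrow> real) \<Rightarrow> ennreal" where
    "Z n p = W (p (T + n), info f q0 (T + n) p)
      + ennreal (exp ((\<Sum>i\<in>{T<..T + n}. (p i)\<^sup>2) / 8) / (4 * 2 ^ n))" for n p
  \<comment> \<open>The strict inequality \<open>j < n\<close> means that \<open>B (Suc n)\<close>
    is decided by the path up to time \<open>T + n\<close>, just before the transition that produces
    \<open>Z (Suc n)\<close>.\<close>
  define B where "B n = {p \<in> A. \<forall>j<n. Z j p < 1}" for n
  have Z_meas [measurable]: "Z n \<in> borel_measurable path_space" for n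
    unfolding Z_def[abs_def] by measurable
  have Z_meas_D [measurable]: "Z n \<in> borel_measurable D" for n
    by measurable
  have adZ: "adapted (T + n) (Z n)" for n
    unfolding adapted_def
  proof (intro allI impI)
    fix p p' :: "nat \<Rightarrow> real" assume eq: "\<forall>i\<le>T + n. p i = p' i"
    then have "info f q0 (T + n) p = info f q0 (T + n) p'" by (intro info_cong) auto
    moreover have "(\<Sum>i\<in>{T<..T + n}. (p i)\<^sup>2) = (\<Sum>i\<in>{T<..T + n}. (p' i)\<^sup>2)"
      using eq by (intro sum.cong) auto
    ultimately show "Z n p = Z n p'" using eq by (simp add: Z_def)
  qed
  have B_Suc: "B (Suc n) = {p \<in> B n. Z n p < 1}" for n
    by (auto simp: B_def less_Suc_eq)
  have B_sets [measurable]: "B n \<in> sets D" for n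
  proof (induction n)
    case 0 then show ?case using A by (simp add: B_def)
  next
    case (Suc n)
    have "B (Suc n) = B n \<inter> {p \<in> space D. Z n p < 1}" by (auto simp: B_Suc)
    moreover have "{p \<in> space D. Z n p < 1} \<in> sets D" by measurable
    ultimately show ?case using Suc by auto
  qed
  have adB: "adapted (T + n) (\<lambda>p. p \<in> B (Suc n))" for n
  proof (induction n)
    case 0
    then show ?case using ad adZ[of 0] unfolding adapted_def by (simp add: B_def) metis
  next
    case (Suc n)
    then have "adapted (T + Suc n) (\<lambda>p. p \<in> B (Suc n))" by (rule adapted_mono) simp
    then show ?case
      using adZ[of "Suc n"] unfolding adapted_def B_Suc[of "Suc n"] mem_Collect_eq by metis
  qed
  \<comment> \<open>The factor 2 from the exponential moment is paid for by the doubling of the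
    denominator \<open>4 * 2 ^ n\<close>.\<close>
  have Z_step: "(\<integral>\<^sup>+b. Z (Suc n) (p(Suc (T + n) := b)) \<partial>gauss (scale f (p (T + n)) (info f q0 (T + n) p)))
      \<le> Z n p" if Z1: "Z n p < 1" for n p
  proof -
    define y q s where "y = p (T + n)" and "q = info f q0 (T + n) p"
      and "s = (\<Sum>i\<in>{T<..T + n}. (p i)\<^sup>2)"
    have q: "q0 \<le> q" "0 < q" using info_ge[of q0 f "T + n" p] q0_pos by (auto simp: q_def)
    have W1: "W (y, q) < 1"
      using Z1 by (auto simp: Z_def y_def q_def intro: le_less_trans[rotated])
    then have "(f y)\<^sup>2 \<le> q" using fail[of q y] q by (meson not_le)
    then have \<sigma>: "1 \<le> scale f y q" "(scale f y q)\<^sup>2 \<le> 2"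
      using q by (auto simp: scale_square scale_ge1)
    have "Z (Suc n) (p(Suc (T + n) := b)) = W (b, q + (f y)\<^sup>2)
        + ennreal (exp (s / 8) / (8 * 2 ^ n)) * ennreal (exp (b\<^sup>2 / 8))" for b
    proof -
      have "(\<Sum>i\<in>{T<..T + Suc n}. ((p(Suc (T + n) := b)) i)\<^sup>2) = s + b\<^sup>2"
      proof -
        have "{T<..T + Suc n} = insert (Suc (T + n)) {T<..T + n}" by auto
        moreover have "(\<Sum>i\<in>{T<..T + n}. ((p(Suc (T + n) := b)) i)\<^sup>2) = s"
          unfolding s_def by (intro sum.cong) auto
        ultimately show ?thesis by (simp add: add.commute)
      qed
      then show ?thesis
        by (simp add: Z_def y_def q_def info_Suc exp_add add_divide_distrib flip: ennreal_mult')
    qed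
    then have "(\<integral>\<^sup>+b. Z (Suc n) (p(Suc (T + n) := b)) \<partial>gauss (scale f y q))
        = (\<integral>\<^sup>+b. W (b, q + (f y)\<^sup>2) + ennreal (exp (s / 8) / (8 * 2 ^ n)) * ennreal (exp (b\<^sup>2 / 8))
            \<partial>gauss (scale f y q))"
      by simp
    also have "\<dots> = (\<integral>\<^sup>+b. W (b, q + (f y)\<^sup>2) \<partial>gauss (scale f y q))
        + ennreal (exp (s / 8) / (8 * 2 ^ n)) * (\<integral>\<^sup>+b. ennreal (exp (b\<^sup>2 / 8)) \<partial>gauss (scale f y q))"
      by (subst nn_integral_add) (auto simp: nn_integral_cmult)
    also have "\<dots> \<le> W (y, q) + ennreal (exp (s / 8) / (8 * 2 ^ n)) * 2"
      using W1 q \<sigma> by (intro add_mono super mult_left_mono gauss_exp_square_le) auto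
    also have "\<dots> = Z n p"
      by (simp add: Z_def y_def q_def s_def flip: ennreal_numeral ennreal_mult')
    finally show ?thesis by (simp add: y_def q_def)
  qed
  \<comment> \<open>Optional stopping and Markov's inequality in one induction: on leaving
    \<open>B n\<close> the process is at least 1, so its integral over the departing paths dominates
    their probability.\<close>
  have bound: "(\<integral>\<^sup>+p. indicator (B n) p * Z n p \<partial>D) + emeasure D (A - B n)
      \<le> (\<integral>\<^sup>+p. indicator A p * Z 0 p \<partial>D)" for n
  proof (induction n)
    case 0
    then show ?case by (simp add: B_def)
  next
    case (Suc n)
    have "(\<integral>\<^sup>+p. indicator (B (Suc n)) p * Z (Suc n) p \<partial>D)
        = (\<integral>\<^sup>+p. \<integral>\<^sup>+b. indicator (B (Suc n)) (p(Suc (T + n) := b)) * Z (Suc n) (p(Suc (T + n) := b))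
            \<partial>gauss (scale f (p (T + n)) (info f q0 (T + n) p)) \<partial>D)"
    proof (rule step)
      show "(\<lambda>p. indicator (B (Suc n)) p * Z (Suc n) p) \<in> borel_measurable path_space"
        by measurable
      have "adapted (Suc (T + n)) (\<lambda>p. p \<in> B (Suc n))"
        by (rule adapted_mono[OF adB]) simp
      then have "adapted (Suc (T + n)) (indicator (B (Suc n)) :: _ \<Rightarrow> ennreal)"
        by (rule adapted_indicator)
      moreover have "adapted (Suc (T + n)) (Z (Suc n))" using adZ[of "Suc n"] by simp
      ultimately show "adapted (Suc (T + n)) (\<lambda>p. indicator (B (Suc n)) p * Z (Suc n) p)"
        unfolding adapted_def by metis
    qed
    also have "\<dots> \<le> (\<integral>\<^sup>+p. indicator (B (Suc n)) p * Z n p \<partial>D)"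
    proof (rule nn_integral_mono)
      fix p
      have "indicator (B (Suc n)) (p(Suc (T + n) := b)) = (indicator (B (Suc n)) p :: ennreal)" for b
        by (rule adapted_upd[OF adapted_indicator[OF adB]]) simp
      then show "(\<integral>\<^sup>+b. indicator (B (Suc n)) (p(Suc (T + n) := b)) * Z (Suc n) (p(Suc (T + n) := b))
            \<partial>gauss (scale f (p (T + n)) (info f q0 (T + n) p))) \<le> indicator (B (Suc n)) p * Z n p"
        using Z_step[of n p] by (cases "p \<in> B (Suc n)") (auto simp: B_Suc)
    qed
    finally have 1: "(\<integral>\<^sup>+p. indicator (B (Suc n)) p * Z (Suc n) p \<partial>D)
        \<le> (\<integral>\<^sup>+p. indicator (B (Suc n)) p * Z n p \<partial>D)" .
    have "emeasure D (B n - B (Suc n)) = (\<integral>\<^sup>+p. indicator (B n - B (Suc n)) p \<partial>D)"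
      by simp
    also have "\<dots> \<le> (\<integral>\<^sup>+p. indicator (B n - B (Suc n)) p * Z n p \<partial>D)"
      by (intro nn_integral_mono) (auto simp: indicator_def B_Suc not_less)
    finally have 2: "emeasure D (B n - B (Suc n)) \<le> (\<integral>\<^sup>+p. indicator (B n - B (Suc n)) p * Z n p \<partial>D)" .
    have "A - B (Suc n) = (A - B n) \<union> (B n - B (Suc n))" by (auto simp: B_def)
    then have 3: "emeasure D (A - B (Suc n)) \<le> emeasure D (A - B n) + emeasure D (B n - B (Suc n))"
      by (simp add: emeasure_subadditive)
    have "(\<integral>\<^sup>+p. indicator (B (Suc n)) p * Z n p \<partial>D) + (\<integral>\<^sup>+p. indicator (B n - B (Suc n)) p * Z n p \<partial>D)
        = (\<integral>\<^sup>+p. indicator (B n) p * Z n p \<partial>D)"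
      by (subst nn_integral_add[symmetric])
         (auto intro!: nn_integral_cong simp: indicator_def B_Suc)
    then have "(\<integral>\<^sup>+p. indicator (B (Suc n)) p * Z (Suc n) p \<partial>D) + emeasure D (A - B (Suc n))
        \<le> (\<integral>\<^sup>+p. indicator (B n) p * Z n p \<partial>D) + emeasure D (A - B n)"
      using add_mono[OF 1 order_trans[OF 3 add_left_mono[OF 2]]]
      by (simp add: add.left_commute[of _ "emeasure D (A - B n)"] add.commute)
    then show ?case using Suc by (rule order_trans)
  qed
  have "(\<integral>\<^sup>+p. indicator A p * Z 0 p \<partial>D) \<le> (\<integral>\<^sup>+p. indicator A p * ennreal (3/4) \<partial>D)"
  proof (rule nn_integral_mono)
    fix p
    show "indicator A p * Z 0 p \<le> indicator A p * ennreal (3/4)"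
    proof (cases "p \<in> A")
      case True
      \<comment> \<open>At the start the sum of squares is empty, so the exponential term is exactly
        1/4.\<close>
      then have "Z 0 p \<le> ennreal (1/2) + ennreal (1/4)"
        using AG unfolding Z_def by (intro add_mono) auto
      also have "\<dots> = ennreal (3/4)"
        by (subst ennreal_plus[symmetric]) auto
      finally show ?thesis using True by simp
    qed simp
  qed
  also have "\<dots> = ennreal (3/4 * prob A)"
    by (subst nn_integral_multc) (auto simp: emeasure_eq_measure mult.commute simp flip: ennreal_mult')
  finally have "emeasure D (A - B n) \<le> ennreal (3/4 * prob A)" for n
    using bound[of n] by (meson add_increasing order_trans zero_le order_refl le_add_same_cancel2)
  then have "prob (A - B n) \<le> 3/4 * prob A" for n
    by (simp add: emeasure_eq_measure)
  note le34 = this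
  have ge: "1/4 * prob A \<le> prob (B n)" for n
  proof -
    have "prob (A - B n) = prob A - prob (B n)"
      by (rule finite_measure_Diff) (auto simp: B_def)
    then show ?thesis using le34[of n] by simp
  qed
  have "decseq B" by (auto simp: decseq_def B_def)
  then have "(\<lambda>n. prob (B n)) \<longlonglongrightarrow> prob (\<Inter>n. B n)"
    by (intro finite_Lim_measure_decseq) auto
  then have "1/4 * prob A \<le> prob (\<Inter>n. B n)"
    by (rule LIMSEQ_le_const) (use ge in auto)
  also have "\<dots> \<le> prob (A \<inter> bounded_average)"
  proof (rule finite_measure_mono)
    show "(\<Inter>n. B n) \<subseteq> A \<inter> bounded_average"
    proof
      fix p assume p: "p \<in> (\<Inter>n. B n)"
      \<comment> \<open>On these paths \<open>Z n p < 1\<close> gives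
        \<open>exp (s / 8) < 4 * 2 ^ n \<le> exp (2 + n)\<close> for the sum \<open>s\<close> of the
        \<open>n\<close> squares after time \<open>T\<close>, hence linear growth; the earlier
        squares go into the constant.\<close>
      have "(\<Sum>i=1..t. (p i)\<^sup>2) \<le> ((\<Sum>i=1..T. (p i)\<^sup>2) + 32) * real t" if t: "t \<ge> 1" for t
      proof (cases "t \<le> T")
        case True
        then have "(\<Sum>i=1..t. (p i)\<^sup>2) \<le> (\<Sum>i=1..T. (p i)\<^sup>2)" by (intro sum_mono2) auto
        also have "\<dots> \<le> ((\<Sum>i=1..T. (p i)\<^sup>2) + 32) * 1" by simp
        also have "\<dots> \<le> ((\<Sum>i=1..T. (p i)\<^sup>2) + 32) * real t"
          using t by (intro mult_left_mono add_nonneg_nonneg sum_nonneg) auto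
        finally show ?thesis .
      next
        case False
        define n where "n = t - T"
        have tn: "t = T + n" using False by (simp add: n_def)
        define s where "s = (\<Sum>i\<in>{T<..T + n}. (p i)\<^sup>2)"
        have "p \<in> B (Suc n)" using p by blast
        then have "Z n p < 1" by (simp add: B_def)
        moreover have "ennreal (exp (s / 8) / (4 * 2 ^ n)) \<le> Z n p"
          unfolding Z_def s_def by simp
        ultimately have "ennreal (exp (s / 8) / (4 * 2 ^ n)) < 1" by (rule le_less_trans[rotated])
        then have "exp (s / 8) < 4 * 2 ^ n"
          by (simp add: ennreal_less_one_iff)
        also have "4 * 2 ^ n \<le> exp (real (2 + n))"
        proof -
          have "(2::real) ^ (2 + n) \<le> exp 1 ^ (2 + n)"
            by (intro power_mono) (use exp_ge_add_one_self[of 1] in auto)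
          also have "\<dots> = exp (real (2 + n))"
            using exp_of_nat_mult[of "2 + n" "1 :: real"] by simp
          finally show ?thesis by (simp add: power_add)
        qed
        finally have "s < 8 * (2 + real n)" by simp
        moreover have "(\<Sum>i=1..t. (p i)\<^sup>2) = (\<Sum>i=1..T. (p i)\<^sup>2) + s"
        proof -
          have eq: "{1..t} = {1..T} \<union> {T<..T + n}" using tn t by auto
          show ?thesis unfolding s_def eq by (rule sum.union_disjoint) auto
        qed
        moreover have "(\<Sum>i=1..T. (p i)\<^sup>2) \<le> (\<Sum>i=1..T. (p i)\<^sup>2) * real t"
          using t mult_left_mono[of 1 "real t" "\<Sum>i=1..T. (p i)\<^sup>2"] by (simp add: sum_nonneg)
        moreover have "8 * (2 + real n) \<le> 32 * real t" using t tn by simp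
        ultimately show ?thesis by (simp add: distrib_right)
      qed
      moreover have "p \<in> A" using p by (auto simp: B_def)
      ultimately show "p \<in> A \<inter> bounded_average" unfolding bounded_average_def by blast
    qed
  qed measurable
  finally show "1/4 * prob A \<le> prob (A \<inter> bounded_average)" .
qed simp

text \<open>A form of Levy's zero-one law for the complement of \<open>bounded_average\<close>, which is approximated
  by the events that a linear bound is broken up to time \<open>n\<close>.\<close>

lemma AE_bounded_average:
  assumes "good {(y, q). q0 \<le> q}"
  shows "AE p in D. p \<in> bounded_average"
proof -
  obtain c where c: "c > 0" "\<And>T A. A \<in> sets D \<Longrightarrow> adapted T (\<lambda>p. p \<in> A) \<Longrightarrow>
     c * prob A \<le> prob (A \<inter> bounded_average)"
    using assms info_ge unfolding good_def by auto
  define U where "U K n = {p. \<exists>t\<in>{1..n}. (\<Sum>i=1..t. (p i)\<^sup>2) > real K * real t}" for K n :: nat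
  define V where "V K = (\<Union>n. U K n)" for K
  have U_sets [measurable]: "U K n \<in> sets D" for K n
  proof -
    have "{p \<in> space D. \<exists>t\<in>{1..n}. (\<Sum>i=1..t. (p i)\<^sup>2) > real K * real t} \<in> sets D"
      by measurable
    then show ?thesis by (simp add: U_def)
  qed
  have V_sets [measurable]: "V K \<in> sets D" for K
    unfolding V_def by measurable
  have adU: "adapted n (\<lambda>p. p \<in> U K n)" for K n
    unfolding adapted_def
  proof (intro allI impI)
    fix p p' :: "nat \<Rightarrow> real" assume eq: "\<forall>i\<le>n. p i = p' i"
    have "(\<Sum>i=1..t. (p i)\<^sup>2) = (\<Sum>i=1..t. (p' i)\<^sup>2)" if "t \<in> {1..n}" for t
      using eq that by (intro sum.cong) auto
    then show "(p \<in> U K n) = (p' \<in> U K n)" unfolding U_def by simp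
  qed
  \<comment> \<open>Whether the bound \<open>K\<close> is broken by time \<open>n\<close> is decided
    at time \<open>n\<close>, so goodness applies to \<open>U K n\<close> with \<open>T = n\<close>;
    continuity from below then gives the inequality for \<open>V K\<close>.\<close>
  have le: "c * prob (V K) \<le> prob (V K \<inter> bounded_average)" for K
  proof -
    have "incseq (U K)" unfolding incseq_def U_def by force
    then have "(\<lambda>n. c * prob (U K n)) \<longlonglongrightarrow> c * prob (V K)"
      unfolding V_def by (intro tendsto_mult_left finite_Lim_measure_incseq) auto
    moreover have "c * prob (U K n) \<le> prob (V K \<inter> bounded_average)" for n
    proof -
      have "c * prob (U K n) \<le> prob (U K n \<inter> bounded_average)"
        by (rule c(2)[OF U_sets adU])
      also have "\<dots> \<le> prob (V K \<inter> bounded_average)"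
        by (rule finite_measure_mono) (auto simp: V_def)
      finally show ?thesis .
    qed
    ultimately show ?thesis by (intro LIMSEQ_le_const2) auto
  qed
  have V_iff: "p \<in> V K \<longleftrightarrow> \<not> (\<forall>t\<ge>1. (\<Sum>i=1..t. (p i)\<^sup>2) \<le> real K * real t)" for p K
    unfolding V_def U_def by (simp add: not_le) (meson atLeastAtMost_iff order_refl)
  have dec: "decseq V"
  proof (intro decseq_SucI subsetI)
    fix K p assume "p \<in> V (Suc K)"
    then obtain t where "1 \<le> t" "real (Suc K) * real t < (\<Sum>i=1..t. (p i)\<^sup>2)"
      unfolding V_iff by (auto simp: not_le)
    moreover have "real K * real t \<le> real (Suc K) * real t" by (intro mult_right_mono) auto
    ultimately show "p \<in> V K" unfolding V_iff by (meson le_less_trans not_le)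
  qed
  \<comment> \<open>As \<open>K\<close> grows, \<open>V K\<close> shrinks to the complement of
    \<open>bounded_average\<close>, while its intersection with \<open>bounded_average\<close>
    shrinks to the empty set; the limit of \<open>le\<close> makes the complement null.\<close>
  have "(\<Inter>K. V K) = - bounded_average"
    unfolding bounded_average_nat using V_iff by auto
  moreover have "(\<lambda>K. prob (V K)) \<longlonglongrightarrow> prob (\<Inter>K. V K)"
    using dec by (intro finite_Lim_measure_decseq) auto
  ultimately have l1: "(\<lambda>K. c * prob (V K)) \<longlonglongrightarrow> c * prob (- bounded_average)"
    by (intro tendsto_mult_left) simp
  have "(\<lambda>K. prob (V K \<inter> bounded_average)) \<longlonglongrightarrow> prob (\<Inter>K. V K \<inter> bounded_average)"
    using dec by (intro finite_Lim_measure_decseq) (auto simp: decseq_def)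
  also have "(\<Inter>K. V K \<inter> bounded_average) = {}"
    unfolding bounded_average_nat using V_iff by auto
  finally have l2: "(\<lambda>K. prob (V K \<inter> bounded_average)) \<longlonglongrightarrow> 0" by simp
  have "c * prob (- bounded_average) \<le> 0"
    by (rule LIMSEQ_le[OF l1 l2]) (use le in auto)
  then have "prob (- bounded_average) = 0"
    using c(1) by (simp add: mult_le_0_iff) (metis measure_nonneg order_antisym)
  moreover have "- bounded_average \<in> sets D"
    using sets.compl_sets[of bounded_average D] sets_bounded_average
    by (simp add: sets_D Compl_eq_Diff_UNIV)
  ultimately have "AE p in D. p \<notin> - bounded_average"
    by (intro AE_not_in) (simp add: null_sets_def emeasure_eq_measure)
  then show ?thesis by simp
qed

end

section \<open>Gaussian lower bounds and fourth moments\<close>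

lemma gauss_ge:
  assumes \<sigma>: "0 < \<sigma>" and A [measurable]: "A \<in> sets borel" and sub: "A \<subseteq> {- (m * \<sigma>)..m * \<sigma>}"
  shows "exp (- m\<^sup>2 / 2) / (sqrt (2 * pi) * \<sigma>) * measure lborel A \<le> measure (gauss \<sigma>) A"
proof -
  interpret prob_space "gauss \<sigma>" by (rule prob_space_gauss[OF \<sigma>])
  define d where "d = exp (- m\<^sup>2 / 2) / (sqrt (2 * pi) * \<sigma>)"
  have d: "0 \<le> d" using \<sigma> by (simp add: d_def)
  have fin: "emeasure lborel A < \<infinity>"
    using emeasure_mono[OF sub, of lborel] by (simp add: emeasure_lborel_Icc_eq le_less_trans split: if_splits)
  \<comment> \<open>Within \<open>m\<close> standard deviations the density is at least its value at
    the edge.\<close>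
  have dens: "d \<le> normal_density 0 \<sigma> b" if "b \<in> A" for b
  proof -
    have "\<bar>b\<bar> \<le> \<bar>m * \<sigma>\<bar>" using sub that by fastforce
    then have "b\<^sup>2 \<le> (m * \<sigma>)\<^sup>2" by (rule abs_le_square_iff[THEN iffD1])
    then have "b\<^sup>2 / (2 * \<sigma>\<^sup>2) \<le> m\<^sup>2 / 2"
      using \<sigma> by (simp add: field_simps power_mult_distrib)
    then show ?thesis
      using \<sigma> unfolding d_def normal_density_def
      by (simp add: real_sqrt_mult divide_right_mono)
  qed
  have "ennreal (d * measure lborel A) = (\<integral>\<^sup>+b. ennreal d * indicator A b \<partial>lborel)"
    using fin d by (simp add: nn_integral_cmult ennreal_mult emeasure_eq_ennreal_measure)
  also have "\<dots> \<le> (\<integral>\<^sup>+b. ennreal (normal_density 0 \<sigma> b) * indicator A b \<partial>lborel)"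
    by (intro nn_integral_mono) (use dens in \<open>auto simp: indicator_def ennreal_leI\<close>)
  also have "\<dots> = emeasure (gauss \<sigma>) A"
    unfolding gauss_def by (rule emeasure_density[symmetric]) auto
  finally show ?thesis by (simp add: emeasure_eq_measure d_def)
qed

text \<open>The scale ranges over the bounded interval from 1 to \<open>R\<close>, so the densities
  on a fixed ball have a common positive lower bound; for \<open>R < 1\<close> there is no
  admissible scale.\<close>

lemma gauss_ball_ge:
  assumes "0 < \<delta>"
  shows "\<exists>c>0. \<forall>\<sigma>. 1 \<le> \<sigma> \<longrightarrow> \<sigma> \<le> R \<longrightarrow> c \<le> measure (gauss \<sigma>) {b. \<bar>b - x\<bar> < \<delta>}"
proof (cases "1 \<le> R")
  case True
  define m where "m = \<bar>x\<bar> + \<delta>"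
  show ?thesis
  proof (intro exI[of _ "exp (- m\<^sup>2 / 2) / (sqrt (2 * pi) * R) * (2 * \<delta>)"] conjI allI impI)
    show "0 < exp (- m\<^sup>2 / 2) / (sqrt (2 * pi) * R) * (2 * \<delta>)"
      using assms True by auto
    fix \<sigma> :: real assume \<sigma>: "1 \<le> \<sigma>" "\<sigma> \<le> R"
    have eq: "{b. \<bar>b - x\<bar> < \<delta>} = {x - \<delta><..<x + \<delta>}" by auto
    have "m * 1 \<le> m * \<sigma>" using \<sigma> assms by (intro mult_left_mono) (auto simp: m_def)
    then have "{x - \<delta><..<x + \<delta>} \<subseteq> {- (m * \<sigma>)..m * \<sigma>}" by (auto simp: m_def)
    then have "exp (- m\<^sup>2 / 2) / (sqrt (2 * pi) * \<sigma>) * measure lborel {x - \<delta><..<x + \<delta>}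
        \<le> measure (gauss \<sigma>) {x - \<delta><..<x + \<delta>}"
      using \<sigma> by (intro gauss_ge) auto
    moreover have "exp (- m\<^sup>2 / 2) / (sqrt (2 * pi) * R) * (2 * \<delta>)
        \<le> exp (- m\<^sup>2 / 2) / (sqrt (2 * pi) * \<sigma>) * measure lborel {x - \<delta><..<x + \<delta>}"
      using \<sigma> assms by (intro mult_mono divide_left_mono) auto
    ultimately show "exp (- m\<^sup>2 / 2) / (sqrt (2 * pi) * R) * (2 * \<delta>)
        \<le> measure (gauss \<sigma>) {b. \<bar>b - x\<bar> < \<delta>}"
      unfolding eq by linarith
  qed
qed (auto intro: exI[of _ 1])

text \<open>Completing the square gives \<open>4 k2 |b| \<le> 32 k2^2 + b^2 / 8\<close>, so the
  fourth power of the exponential bound is dominated by a multiple of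
  \<open>exp (b^2 / 8)\<close>.\<close>

lemma gauss_fourth_moment_le:
  assumes bound: "\<And>x. \<bar>f x\<bar> \<le> k1 * exp (k2 * \<bar>x\<bar>)" and \<sigma>: "1 \<le> \<sigma>" "\<sigma>\<^sup>2 \<le> 2"
  shows "(\<integral>\<^sup>+b. ennreal ((f b) ^ 4) \<partial>gauss \<sigma>) \<le> ennreal (2 * k1 ^ 4 * exp (32 * k2\<^sup>2))"
proof -
  have le: "(f b) ^ 4 \<le> k1 ^ 4 * exp (32 * k2\<^sup>2) * exp (b\<^sup>2 / 8)" for b
  proof -
    have "\<bar>f b\<bar> ^ 4 \<le> (k1 * exp (k2 * \<bar>b\<bar>)) ^ 4" by (rule power_mono[OF bound]) simp
    also have "\<dots> = k1 ^ 4 * exp (4 * (k2 * \<bar>b\<bar>))"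
      by (simp add: power_mult_distrib exp_of_nat_mult[of 4, simplified])
    also have "4 * (k2 * \<bar>b\<bar>) \<le> 32 * k2\<^sup>2 + b\<^sup>2 / 8"
    proof -
      have "0 \<le> (\<bar>b\<bar> - 16 * k2)\<^sup>2" by simp
      also have "\<dots> = b\<^sup>2 + 256 * k2\<^sup>2 - 32 * (k2 * \<bar>b\<bar>)"
        by (simp add: power2_diff power_mult_distrib)
      finally show ?thesis by simp
    qed
    finally show ?thesis by (simp add: exp_add mult_left_mono mult.assoc)
  qed
  have "(\<integral>\<^sup>+b. ennreal ((f b) ^ 4) \<partial>gauss \<sigma>)
      \<le> (\<integral>\<^sup>+b. ennreal (k1 ^ 4 * exp (32 * k2\<^sup>2)) * ennreal (exp (b\<^sup>2 / 8)) \<partial>gauss \<sigma>)"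
    by (intro nn_integral_mono) (use le in \<open>simp add: ennreal_leI flip: ennreal_mult'\<close>)
  also have "\<dots> = ennreal (k1 ^ 4 * exp (32 * k2\<^sup>2)) * (\<integral>\<^sup>+b. ennreal (exp (b\<^sup>2 / 8)) \<partial>gauss \<sigma>)"
    by (rule nn_integral_cmult) measurable
  also have "\<dots> \<le> ennreal (k1 ^ 4 * exp (32 * k2\<^sup>2)) * 2"
    by (intro mult_left_mono gauss_exp_square_le \<sigma>) auto
  also have "\<dots> = ennreal (2 * k1 ^ 4 * exp (32 * k2\<^sup>2))"
    by (simp add: mult_ac flip: ennreal_numeral ennreal_mult')
  finally show ?thesis .
qed

section \<open>The case of almost everywhere vanishing \<open>f\<close>\<close>

context gaussian_path
begin

text \<open>Each transition has a density, so it lands almost surely where \<open>f\<close>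
  vanishes, and from there the variance stays 1. The indicator of \<open>f \<noteq> 0\<close> is the
  supermartingale, and one further transition covers arbitrary starting states.\<close>

lemma good_null:
  assumes "AE x in lborel. f x = 0"
  shows "good {(y, q). q0 \<le> q}"
proof -
  have AE0: "AE b in gauss \<sigma>. f b = 0" for \<sigma>
    unfolding gauss_def by (subst AE_density) (use assms in auto)
  define W :: "real \<times> real \<Rightarrow> ennreal" where "W x = (if f (fst x) = 0 then 0 else 1)" for x
  have W_meas [measurable]: "W \<in> borel_measurable (borel \<Otimes>\<^sub>M borel)"
    unfolding W_def[abs_def] by measurable
  have "good {x. W x \<le> ennreal (1/2)}"
  proof (rule good_supermartingale[OF W_meas])
    fix y q assume "q0 \<le> q" "q < (f y)\<^sup>2"
    then show "1 \<le> W (y, q)" using q0_pos by (auto simp: W_def)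
  next
    fix y q
    have "(\<integral>\<^sup>+b. W (b, q + (f y)\<^sup>2) \<partial>gauss (scale f y q)) = (\<integral>\<^sup>+b. 0 \<partial>gauss (scale f y q))"
      by (rule nn_integral_cong_AE) (use AE0 in eventually_elim, simp add: W_def)
    then show "(\<integral>\<^sup>+b. W (b, q + (f y)\<^sup>2) \<partial>gauss (scale f y q)) \<le> W (y, q)" by simp
  qed
  then have "good {x. f (fst x) = 0}"
    by (rule good_mono) (auto simp: W_def)
  moreover have "{x :: real \<times> real. f (fst x) = 0} \<in> sets (borel \<Otimes>\<^sub>M borel)"
  proof -
    have "{x \<in> space (borel \<Otimes>\<^sub>M borel). f (fst x) = 0} \<in> sets (borel \<Otimes>\<^sub>M (borel :: real measure))"
      by measurable
    then show ?thesis by (simp add: space_pair_measure)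
  qed
  ultimately show ?thesis
  proof (rule good_step[where \<delta> = 1])
    fix y q assume "q0 \<le> q"
    then have "0 < scale f y q" using q0_pos scale_ge1[of q f y] by linarith
    then interpret N: prob_space "gauss (scale f y q)" by (rule prob_space_gauss)
    have "{b \<in> space borel. f b = 0} \<in> sets borel" by measurable
    then have "N.prob {b. f b = 0} = 1"
      using AE0 by (subst N.prob_eq_1) auto
    then show "1 \<le> N.prob {b. (b, q + (f y)\<^sup>2) \<in> {x. f (fst x) = 0}}" by simp
  qed simp
qed

end

section \<open>Chains with an interval on which \<open>f\<close> is bounded away from zero\<close>

locale excited_gaussian_path = gaussian_path +
  fixes k1 k2 x \<delta> \<eta> H :: real
  assumes exp_bound: "\<And>x. \<bar>f x\<bar> \<le> k1 * exp (k2 * \<bar>x\<bar>)" and k1_pos: "0 < k1"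
    and \<delta>_pos: "0 < \<delta>" and \<eta>_pos: "0 < \<eta>"
    and excited: "\<And>b. \<bar>b - x\<bar> < \<delta> \<Longrightarrow> \<eta> \<le> \<bar>f b\<bar> \<and> \<bar>f b\<bar> \<le> H"
begin

lemma excited_square:
  assumes "\<bar>b - x\<bar> < \<delta>" shows "\<eta>\<^sup>2 \<le> (f b)\<^sup>2" "(f b)\<^sup>2 \<le> H\<^sup>2"
  using excited[OF assms] \<eta>_pos by (auto simp: abs_le_square_iff[symmetric])

text \<open>A multiple of the reciprocal precision is a supermartingale: leaving the regime has
  probability at most \<open>K / q'^2\<close> by the fourth moment, and visits to the interval
  decrease the function by at least as much on average.\<close>

lemma good_large_info: "\<exists>Q. good {(y, q). (f y)\<^sup>2 \<le> q \<and> Q \<le> q}"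
proof -
  obtain c where c: "0 < c"
    "\<And>\<sigma>. 1 \<le> \<sigma> \<Longrightarrow> \<sigma> \<le> sqrt 2 \<Longrightarrow> c \<le> measure (gauss \<sigma>) {b. \<bar>b - x\<bar> < \<delta>}"
    using gauss_ball_ge[OF \<delta>_pos, of "sqrt 2" x] by blast
  define K where "K = 2 * k1 ^ 4 * exp (32 * k2\<^sup>2)"
  \<comment> \<open>The last entry makes the expected decrease at least \<open>K / q'^2\<close>. The
    others are used once \<open>W < 1\<close> forces \<open>q' > \<alpha>\<close>: then
    \<open>q' + \<eta>^2 \<le> 2 q'\<close>, and a visit to the interval, where
    \<open>f^2 \<le> H^2\<close>, is never a failure.\<close>
  define \<alpha> where "\<alpha> = max (H\<^sup>2) (max (\<eta>\<^sup>2) (2 * K / (c * \<eta>\<^sup>2)))"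
  have K: "0 < K" using k1_pos by (simp add: K_def)
  have \<alpha>: "H\<^sup>2 \<le> \<alpha>" "\<eta>\<^sup>2 \<le> \<alpha>" "2 * K \<le> \<alpha> * (c * \<eta>\<^sup>2)" "0 < \<alpha>"
  proof -
    show "H\<^sup>2 \<le> \<alpha>" "\<eta>\<^sup>2 \<le> \<alpha>" by (auto simp: \<alpha>_def)
    have "0 < \<eta>\<^sup>2" using \<eta>_pos by simp
    then show "0 < \<alpha>" using \<open>\<eta>\<^sup>2 \<le> \<alpha>\<close> by linarith
    have "2 * K / (c * \<eta>\<^sup>2) \<le> \<alpha>" by (auto simp: \<alpha>_def)
    then show "2 * K \<le> \<alpha> * (c * \<eta>\<^sup>2)" using c \<eta>_pos by (simp add: field_simps)
  qed
  \<comment> \<open>The denominator is the precision after the next transition, which is already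
    known at the current state; failure has the value 1.\<close>
  define W :: "real \<times> real \<Rightarrow> ennreal" where
    "W z = (if (f (fst z))\<^sup>2 \<le> snd z then ennreal (\<alpha> / (snd z + (f (fst z))\<^sup>2)) else 1)" for z
  have W_meas [measurable]: "W \<in> borel_measurable (borel \<Otimes>\<^sub>M borel)"
    unfolding W_def[abs_def] by measurable
  have "good {z. W z \<le> ennreal (1/2)}"
  proof (rule good_supermartingale[OF W_meas])
    fix y q assume "q0 \<le> q" "q < (f y)\<^sup>2"
    then show "1 \<le> W (y, q)" by (auto simp: W_def)
  next
    fix y q assume q: "q0 \<le> q" and W1: "W (y, q) < 1"
    then have fy: "(f y)\<^sup>2 \<le> q" and q_pos: "0 < q" using q0_pos by (auto simp: W_def split: if_splits)
    define q' where "q' = q + (f y)\<^sup>2"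
    define \<sigma> where "\<sigma> = scale f y q"
    have q'_pos: "0 < q'" using q_pos by (simp add: q'_def add_pos_nonneg)
    have Wq: "W (y, q) = ennreal (\<alpha> / q')" using fy by (simp add: W_def q'_def)
    then have "\<alpha> / q' < 1" using W1 \<alpha>(4) q'_pos by (simp add: ennreal_less_one_iff)
    then have q': "\<alpha> < q'" using q'_pos by simp
    have \<sigma>: "1 \<le> \<sigma>" "\<sigma>\<^sup>2 \<le> 2" using fy q_pos by (auto simp: \<sigma>_def scale_square scale_ge1)
    then have \<sigma>2: "\<sigma> \<le> sqrt 2" by (intro real_le_rsqrt)
    interpret N: prob_space "gauss \<sigma>" by (rule prob_space_gauss) (use \<sigma> in simp)
    define I where "I = {b. \<bar>b - x\<bar> < \<delta>}"
    have I [measurable]: "I \<in> sets borel"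
    proof -
      have "{b \<in> space borel. \<bar>b - x\<bar> < \<delta>} \<in> sets borel" by measurable
      then show ?thesis by (simp add: I_def)
    qed
    \<comment> \<open>The least decrease of \<open>\<alpha> / q'\<close> when the precision gains at
      least \<open>\<eta>^2\<close>, as it does from a state in the interval.\<close>
    define d where "d = \<alpha> / q' - \<alpha> / (q' + \<eta>\<^sup>2)"
    have d_eq: "d = \<alpha> * \<eta>\<^sup>2 / (q' * (q' + \<eta>\<^sup>2))"
    proof -
      have "q' \<noteq> 0" "q' + \<eta>\<^sup>2 \<noteq> 0" using q'_pos zero_le_power2[of \<eta>] by linarith+
      then show ?thesis
        unfolding d_def by (subst diff_frac_eq) (auto simp: algebra_simps)
    qed
    have d0: "0 \<le> d" using \<alpha>(4) q'_pos by (simp add: d_eq)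
    have Kd: "K / q'\<^sup>2 \<le> d * N.prob I"
    proof -
      have "K / q'\<^sup>2 \<le> (\<alpha> * \<eta>\<^sup>2 * c / 2) / q'\<^sup>2"
        using \<alpha>(3) by (intro divide_right_mono) (auto simp: mult_ac)
      also have "\<dots> = (\<alpha> * \<eta>\<^sup>2 * c) / (q' * (2 * q'))" by (simp add: power2_eq_square)
      also have "\<dots> \<le> (\<alpha> * \<eta>\<^sup>2 * c) / (q' * (q' + \<eta>\<^sup>2))"
        using \<alpha> q' q'_pos c(1) \<eta>_pos by (intro divide_left_mono mult_left_mono mult_pos_pos add_pos_pos) auto
      also have "\<dots> = d * c" by (simp add: d_eq)
      also have "\<dots> \<le> d * N.prob I"
        unfolding I_def using c(2)[OF \<sigma>(1) \<sigma>2] d0 by (intro mult_left_mono)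
      finally show ?thesis .
    qed
    \<comment> \<open>Without failure \<open>W\<close> does not exceed \<open>\<alpha> / q'\<close>,
      and inside the interval it drops by \<open>d\<close>; a failure costs 1, which is at most
      \<open>(f b)^4 / q'^2\<close>.\<close>
    have pt: "W (b, q') + ennreal d * indicator I b
        \<le> ennreal (1 / q'\<^sup>2) * ennreal ((f b) ^ 4) + ennreal (\<alpha> / q')" for b
    proof (cases "(f b)\<^sup>2 \<le> q'")
      case True
      have "\<alpha> / (q' + (f b)\<^sup>2) + d * indicator I b \<le> \<alpha> / q'"
      proof (cases "b \<in> I")
        case True
        then have "\<alpha> / (q' + (f b)\<^sup>2) \<le> \<alpha> / (q' + \<eta>\<^sup>2)"
          using excited_square(1)[of b] \<alpha>(4) q'_pos
          by (intro divide_left_mono mult_pos_pos add_pos_nonneg) (auto simp: I_def)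
        then show ?thesis using True by (simp add: d_def)
      next
        case False
        then show ?thesis using \<alpha>(4) q'_pos
          by (auto intro!: divide_left_mono mult_pos_pos add_pos_nonneg)
      qed
      then have "ennreal (\<alpha> / (q' + (f b)\<^sup>2)) + ennreal d * indicator I b \<le> ennreal (\<alpha> / q')"
        using \<alpha>(4) q'_pos d0
        by (cases "b \<in> I") (auto simp: ennreal_leI simp flip: ennreal_plus)
      then show ?thesis using True by (simp add: W_def add_increasing)
    next
      case False
      then have "b \<notin> I" using excited_square(2)[of b] \<alpha>(1) q' by (auto simp: I_def)
      have "q'\<^sup>2 \<le> ((f b)\<^sup>2)\<^sup>2" using False q'_pos by (intro power_mono) auto
      then have "1 \<le> 1 / q'\<^sup>2 * (f b) ^ 4" using q'_pos by (simp add: field_simps)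
      then have "1 \<le> ennreal (1 / q'\<^sup>2) * ennreal ((f b) ^ 4)"
        by (simp add: ennreal_leI flip: ennreal_1 ennreal_mult')
      then show ?thesis using False \<open>b \<notin> I\<close> by (simp add: W_def add_increasing2)
    qed
    \<comment> \<open>The drift inequality is proved with the finite term \<open>K / q'^2\<close>
      added on both sides and cancelled at the end, which avoids truncated subtraction.\<close>
    have "(\<integral>\<^sup>+b. W (b, q') \<partial>gauss \<sigma>) + ennreal (K / q'\<^sup>2)
        \<le> (\<integral>\<^sup>+b. W (b, q') \<partial>gauss \<sigma>) + ennreal d * emeasure (gauss \<sigma>) I"
      using Kd d0 by (intro add_left_mono) (simp add: N.emeasure_eq_measure ennreal_leI flip: ennreal_mult')
    also have "\<dots> = (\<integral>\<^sup>+b. W (b, q') + ennreal d * indicator I b \<partial>gauss \<sigma>)"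
      by (subst nn_integral_add) (auto simp: nn_integral_cmult)
    also have "\<dots> \<le> (\<integral>\<^sup>+b. ennreal (1 / q'\<^sup>2) * ennreal ((f b) ^ 4) + ennreal (\<alpha> / q') \<partial>gauss \<sigma>)"
      by (intro nn_integral_mono pt)
    also have "\<dots> = ennreal (1 / q'\<^sup>2) * (\<integral>\<^sup>+b. ennreal ((f b) ^ 4) \<partial>gauss \<sigma>) + ennreal (\<alpha> / q')"
      using N.emeasure_space_1 by (subst nn_integral_add) (auto simp: nn_integral_cmult)
    also have "\<dots> \<le> ennreal (1 / q'\<^sup>2) * ennreal K + ennreal (\<alpha> / q')"
      unfolding K_def by (intro add_right_mono mult_left_mono gauss_fourth_moment_le exp_bound \<sigma>) auto
    also have "\<dots> = ennreal (\<alpha> / q') + ennreal (K / q'\<^sup>2)"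
      using K by (simp add: add.commute flip: ennreal_mult')
    finally show "(\<integral>\<^sup>+b. W (b, q + (f y)\<^sup>2) \<partial>gauss (scale f y q)) \<le> W (y, q)"
      by (simp add: Wq q'_def \<sigma>_def add.commute[of _ "ennreal (K / _)"] ennreal_add_left_cancel_le)
  qed
  then have "good {(y, q). (f y)\<^sup>2 \<le> q \<and> 2 * \<alpha> \<le> q}"
  proof (rule good_mono, safe)
    fix y q assume "(f y)\<^sup>2 \<le> q" "2 * \<alpha> \<le> q"
    have "\<alpha> / (q + (f y)\<^sup>2) \<le> 1 / 2"
    proof -
      have "2 * \<alpha> \<le> q + (f y)\<^sup>2" using \<open>2 * \<alpha> \<le> q\<close> by (simp add: add_increasing2)
      then show ?thesis using \<alpha>(4) by (simp add: field_simps)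
    qed
    then have "ennreal (\<alpha> / (q + (f y)\<^sup>2)) \<le> ennreal (1/2)" by (rule ennreal_leI)
    then show "W (y, q) \<le> ennreal (1/2)"
      using \<open>(f y)\<^sup>2 \<le> q\<close> unfolding W_def by (simp only: fst_conv snd_conv if_True)
  qed
  then show ?thesis by blast
qed

text \<open>From a bounded scale, a visit to the interval has probability bounded below, and each
  visit adds at least \<open>\<eta>^2\<close> to the precision; finitely many successive visits
  reach the regime of \<open>good_large_info\<close>.\<close>

lemma good_bounded_scale: "good {(y, q). q0 \<le> q \<and> scale f y q \<le> R}"
proof -
  obtain Q where Q: "good {(y, q). (f y)\<^sup>2 \<le> q \<and> Q \<le> q}" using good_large_info by blast
  \<comment> \<open>The index counts the gains of \<open>\<eta>^2\<close> already secured; the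
    contribution of the current visit is not yet included in \<open>q\<close>.\<close>
  define J where "J k = {(y, q). \<bar>y - x\<bar> < \<delta> \<and> q0 + real k * \<eta>\<^sup>2 \<le> q}" for k
  have J_sets: "J k \<in> sets (borel \<Otimes>\<^sub>M borel)" for k
  proof -
    have "{z \<in> space (borel \<Otimes>\<^sub>M borel). \<bar>fst z - x\<bar> < \<delta> \<and> q0 + real k * \<eta>\<^sup>2 \<le> snd z}
        \<in> sets (borel \<Otimes>\<^sub>M (borel :: real measure))"
      by measurable
    moreover have "J k = {z \<in> space (borel \<Otimes>\<^sub>M borel). \<bar>fst z - x\<bar> < \<delta> \<and> q0 + real k * \<eta>\<^sup>2 \<le> snd z}"
      by (auto simp: J_def space_pair_measure)
    ultimately show ?thesis by simp
  qed
  \<comment> \<open>At this count \<open>q\<close> is at least \<open>Q\<close> and at least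
    \<open>H^2\<close>, and the latter bounds \<open>f^2\<close> on the interval.\<close>
  obtain n where n: "max Q (H\<^sup>2) \<le> real n * \<eta>\<^sup>2"
    using real_arch_simple[of "max Q (H\<^sup>2) / \<eta>\<^sup>2"] \<eta>_pos by (auto simp: field_simps)
  have "J n \<subseteq> {(y, q). (f y)\<^sup>2 \<le> q \<and> Q \<le> q}"
  proof clarsimp
    fix y q assume "(y, q) \<in> J n"
    then have "\<bar>y - x\<bar> < \<delta>" "max Q (H\<^sup>2) \<le> q" using n q0_pos by (auto simp: J_def)
    then show "(f y)\<^sup>2 \<le> q \<and> Q \<le> q" using excited_square(2)[of y] by auto
  qed
  then have "good (J n)" by (rule good_mono[OF Q])
  have step_J: "good {(y, q). q0 + real k * \<eta>\<^sup>2 \<le> q + (f y)\<^sup>2 \<and> q0 \<le> q \<and> scale f y q \<le> R'}"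
    if Jk: "good (J k)" for k R'
  proof -
    obtain c where c: "0 < c"
      "\<And>\<sigma>. 1 \<le> \<sigma> \<Longrightarrow> \<sigma> \<le> R' \<Longrightarrow> c \<le> measure (gauss \<sigma>) {b. \<bar>b - x\<bar> < \<delta>}"
      using gauss_ball_ge[OF \<delta>_pos, of R' x] by blast
    show ?thesis
    proof (rule good_step[OF Jk J_sets c(1)], clarsimp)
      fix y q assume "q0 + real k * \<eta>\<^sup>2 \<le> q + (f y)\<^sup>2" "q0 \<le> q" "scale f y q \<le> R'"
      then show "c \<le> measure (gauss (scale f y q)) {b. (b, q + (f y)\<^sup>2) \<in> J k}"
        using c(2)[of "scale f y q"] scale_ge1[of q f y] q0_pos by (simp add: J_def)
    qed
  qed
  \<comment> \<open>Downward induction from \<open>n\<close> by truncated subtraction. Inside the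
    interval the scale is at most \<open>sqrt (1 + H^2 / q0)\<close>, so \<open>step_J\<close>
    applies.\<close>
  have "good (J (n - k))" for k
  proof (induction k)
    case 0 then show ?case using \<open>good (J n)\<close> by simp
  next
    case (Suc k)
    show ?case
    proof (cases "n - k = 0")
      case False
      define m where "m = n - Suc k"
      have m: "n - k = Suc m" using False by (simp add: m_def)
      have "J m \<subseteq> {(y, q). q0 + real (Suc m) * \<eta>\<^sup>2 \<le> q + (f y)\<^sup>2 \<and> q0 \<le> q
          \<and> scale f y q \<le> sqrt (1 + H\<^sup>2 / q0)}"
      proof clarify
        fix y q assume "(y, q) \<in> J m"
        then have y: "\<bar>y - x\<bar> < \<delta>" and q: "q0 + real m * \<eta>\<^sup>2 \<le> q" by (auto simp: J_def)
        moreover have "0 \<le> real m * \<eta>\<^sup>2" by simp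
        ultimately have "q0 \<le> q" by linarith
        moreover have "(f y)\<^sup>2 / q \<le> H\<^sup>2 / q0"
          using excited_square(2)[OF y] \<open>q0 \<le> q\<close> q0_pos by (intro frac_le) auto
        ultimately show "q0 + real (Suc m) * \<eta>\<^sup>2 \<le> q + (f y)\<^sup>2 \<and> q0 \<le> q
            \<and> scale f y q \<le> sqrt (1 + H\<^sup>2 / q0)"
          using excited_square(1)[OF y] q by (simp add: scale_def distrib_right)
      qed
      moreover have "good (J (Suc m))" using Suc m by simp
      ultimately show ?thesis
        unfolding m_def[symmetric] using good_mono[OF step_J[of "Suc m"]] by blast
    qed (use Suc in simp)
  qed
  from this[of n] have "good (J 0)" by simp
  then show ?thesis
    by (rule good_mono[OF step_J]) (auto simp: add_increasing2)
qed

text \<open>With \<open>u = ln (q + f(y)\<^sup>2) / ln q\<close>, hitting the set where \<open>f\<close> grows like a power \<open>\<beta>\<close> replaces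
  \<open>u\<close> by at most \<open>\<beta> - \<beta> / u\<close> up to a small error; as \<open>\<beta> < 4\<close>, this is less than \<open>u\<close> by a fixed amount.\<close>

lemma good_all:
  assumes r: "0 < r" and hit: "\<And>\<sigma>. R0 \<le> \<sigma> \<Longrightarrow>
      r \<le> measure (gauss \<sigma>) {b. 1 \<le> \<bar>b\<bar> \<and> \<bar>b\<bar> \<le> \<sigma> \<and> \<bar>f b\<bar> < L * \<bar>b\<bar> powr \<beta>}"
    and \<beta>: "0 < \<beta>" "\<beta> < 4" and L: "0 < L"
  shows "good {(y, q). q0 \<le> q}"
proof -
  define C where "C = ln (2 * L\<^sup>2)"
  \<comment> \<open>The gain \<open>u - \<beta> + \<beta> / u\<close> equals
    \<open>(u^2 - \<beta> u + \<beta>) / u\<close>. The quadratic is at least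
    \<open>\<beta> - \<beta>^2 / 4\<close>, positive for \<open>0 < \<beta> < 4\<close>, and
    \<open>u\<close> stays at most \<open>\<beta> + 1\<close>, so the gain is at least
    \<open>2 d\<close>: one \<open>d\<close> absorbs the constant \<open>C\<close>, the other is
    progress.\<close>
  define d where "d = (\<beta> - \<beta>\<^sup>2 / 4) / (\<beta> + 1) / 2"
  have d: "0 < d"
  proof -
    have "\<beta> * \<beta> < 4 * \<beta>" using \<beta> by (intro mult_strict_right_mono) auto
    then show ?thesis unfolding d_def using \<beta> by (simp add: power2_eq_square)
  qed
  \<comment> \<open>Above this level \<open>C\<close> is at most \<open>d\<close> times the
    logarithm of the precision; the third entry handles the first hit from an arbitrary
    state.\<close>
  define \<Lambda> where "\<Lambda> = max 1 (max (C / d) (C - \<beta> * ln q0))"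
  have \<Lambda>: "1 \<le> \<Lambda>" "C \<le> d * \<Lambda>" "C - \<beta> * ln q0 \<le> \<Lambda>"
  proof -
    have "C / d \<le> \<Lambda>" by (auto simp: \<Lambda>_def)
    then show "C \<le> d * \<Lambda>" using d by (simp add: field_simps)
  qed (auto simp: \<Lambda>_def)
  \<comment> \<open>The bound 2 places hits with \<open>f(b)^2 \<le> q + f(y)^2\<close> in
    \<open>S\<close>, \<open>R0\<close> makes \<open>hit\<close> applicable, and the third entry
    lifts the logarithm of the next precision to \<open>\<Lambda>\<close> outside
    \<open>S\<close>.\<close>
  define R where "R = max 2 (max R0 (sqrt (exp \<Lambda> / q0)))"
  have R: "2 \<le> R" "R0 \<le> R" "sqrt (exp \<Lambda> / q0) \<le> R" by (auto simp: R_def)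
  define hits where "hits \<sigma> = {b. 1 \<le> \<bar>b\<bar> \<and> \<bar>b\<bar> \<le> \<sigma> \<and> \<bar>f b\<bar> < L * \<bar>b\<bar> powr \<beta>}" for \<sigma>
  define S where "S = {(y, q). q0 \<le> q \<and> scale f y q \<le> R}"
  define G where "G u = {(y, q). q0 \<le> q \<and> \<Lambda> \<le> ln q \<and> ln (q + (f y)\<^sup>2) \<le> u * ln q}" for u
  have S_good: "good S" unfolding S_def by (rule good_bounded_scale)
  have S_sets [measurable]: "S \<in> sets (borel \<Otimes>\<^sub>M borel)"
  proof -
    have "{z \<in> space (borel \<Otimes>\<^sub>M borel). q0 \<le> snd z \<and> sqrt (1 + (f (fst z))\<^sup>2 / snd z) \<le> R}
        \<in> sets (borel \<Otimes>\<^sub>M (borel :: real measure))"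
      by measurable
    moreover have "S = {z \<in> space (borel \<Otimes>\<^sub>M borel). q0 \<le> snd z \<and> sqrt (1 + (f (fst z))\<^sup>2 / snd z) \<le> R}"
      by (auto simp: S_def scale_def space_pair_measure)
    ultimately show ?thesis by simp
  qed
  have G_sets [measurable]: "G u \<in> sets (borel \<Otimes>\<^sub>M borel)" for u
  proof -
    have "{z \<in> space (borel \<Otimes>\<^sub>M borel). q0 \<le> snd z \<and> \<Lambda> \<le> ln (snd z)
          \<and> ln (snd z + (f (fst z))\<^sup>2) \<le> u * ln (snd z)} \<in> sets (borel \<Otimes>\<^sub>M (borel :: real measure))"
      by measurable
    moreover have "G u = {z \<in> space (borel \<Otimes>\<^sub>M borel). q0 \<le> snd z \<and> \<Lambda> \<le> ln (snd z)
          \<and> ln (snd z + (f (fst z))\<^sup>2) \<le> u * ln (snd z)}"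
      by (auto simp: G_def space_pair_measure)
    ultimately show ?thesis by simp
  qed
  \<comment> \<open>Put \<open>q' = q + f(y)^2\<close>. If \<open>f(b)^2\<close> exceeds
    \<open>q'\<close>, then \<open>q' + f(b)^2\<close> is at most \<open>2 f(b)^2\<close>, hence at
    most \<open>2 L^2\<close> times the power \<open>\<beta>\<close> of the squared scale
    \<open>q' / q\<close>; logarithms give the recursion.\<close>
  have hit_ln: "scale f b (q + (f y)\<^sup>2) \<le> R \<or>
      ln (q + (f y)\<^sup>2 + (f b)\<^sup>2) \<le> C + \<beta> * (ln (q + (f y)\<^sup>2) - ln q)"
    if q: "q0 \<le> q" and big: "R < scale f y q" and b: "b \<in> hits (scale f y q)" for y q b
  proof (cases "(f b)\<^sup>2 \<le> q + (f y)\<^sup>2")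
    case True
    then have "(scale f b (q + (f y)\<^sup>2))\<^sup>2 \<le> R\<^sup>2"
    proof -
      have "0 < q + (f y)\<^sup>2" using q q0_pos by (simp add: add_pos_nonneg)
      then have "(scale f b (q + (f y)\<^sup>2))\<^sup>2 \<le> 2\<^sup>2" using True by (simp add: scale_square divide_le_eq)
      also have "\<dots> \<le> R\<^sup>2" using R(1) by (intro power_mono) auto
      finally show ?thesis .
    qed
    then show ?thesis using R(1) by (auto intro: power2_le_imp_le)
  next
    case False
    define q' where "q' = q + (f y)\<^sup>2"
    have pos: "0 < q" "0 < q'" using q q0_pos by (auto simp: q'_def add_pos_nonneg)
    have sq: "(scale f y q)\<^sup>2 = q' / q" using pos by (simp add: scale_square q'_def field_simps)
    have \<sigma>_pos: "0 < scale f y q" using big R(1) by linarith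
    have "\<bar>f b\<bar> \<le> L * (scale f y q) powr \<beta>"
    proof -
      have "\<bar>f b\<bar> \<le> L * \<bar>b\<bar> powr \<beta>" using b by (simp add: hits_def)
      also have "\<dots> \<le> L * (scale f y q) powr \<beta>"
        using b \<beta> L by (intro mult_left_mono powr_mono2) (auto simp: hits_def)
      finally show ?thesis .
    qed
    then have "(f b)\<^sup>2 \<le> (L * (scale f y q) powr \<beta>)\<^sup>2"
      using L by (simp add: abs_le_square_iff[symmetric])
    also have "\<dots> = L\<^sup>2 * ((scale f y q)\<^sup>2) powr \<beta>"
      using \<sigma>_pos by (simp add: power2_eq_square powr_mult mult_ac)
    finally have "q' + (f b)\<^sup>2 \<le> 2 * L\<^sup>2 * (q' / q) powr \<beta>"
      using False by (simp add: sq q'_def)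
    moreover have "0 < q' + (f b)\<^sup>2" using pos by (simp add: add_pos_nonneg)
    ultimately have "ln (q' + (f b)\<^sup>2) \<le> ln (2 * L\<^sup>2 * (q' / q) powr \<beta>)"
      by (rule ln_mono)
    also have "\<dots> = C + \<beta> * (ln q' - ln q)"
      using L pos by (subst ln_mult) (auto simp: C_def ln_powr ln_div)
    finally show ?thesis by (simp add: q'_def)
  qed
  \<comment> \<open>States of \<open>X\<close> inside \<open>S\<close> are good already; from the
    others a hit, of probability at least \<open>r\<close>, leads into
    \<open>S \<union> G u\<close>.\<close>
  have pass: "good X" if Gu: "good (G u)" and X: "\<And>y q. (y, q) \<in> X \<Longrightarrow> q0 \<le> q"
    and to: "\<And>y q b. (y, q) \<in> X \<Longrightarrow> R < scale f y q \<Longrightarrow> b \<in> hits (scale f y q) \<Longrightarrow>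
      (b, q + (f y)\<^sup>2) \<in> S \<union> G u" for X u
  proof -
    have "good (S \<union> G u)" by (rule good_Un[OF S_good Gu S_sets])
    then have "good (X - S)"
    proof (rule good_step[OF _ _ r])
      fix y q assume yq: "(y, q) \<in> X - S" "q0 \<le> q"
      then have big: "R < scale f y q" by (auto simp: S_def not_le)
      then have "0 < scale f y q" using R(1) by linarith
      then interpret N: prob_space "gauss (scale f y q)" by (rule prob_space_gauss)
      have "r \<le> N.prob (hits (scale f y q))"
        unfolding hits_def using big R(2) by (intro hit) simp
      also have "\<dots> \<le> N.prob {b. (b, q + (f y)\<^sup>2) \<in> S \<union> G u}"
      proof (rule N.finite_measure_mono)
        show "hits (scale f y q) \<subseteq> {b. (b, q + (f y)\<^sup>2) \<in> S \<union> G u}"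
          using to yq big by blast
        have "{b \<in> space borel. (b, q + (f y)\<^sup>2) \<in> S \<union> G u} \<in> sets borel" by measurable
        then show "{b. (b, q + (f y)\<^sup>2) \<in> S \<union> G u} \<in> N.events" by simp
      qed
      finally show "r \<le> N.prob {b. (b, q + (f y)\<^sup>2) \<in> S \<union> G u}" .
    qed measurable
    then have "good (S \<union> (X - S))" by (rule good_Un[OF S_good _ S_sets])
    then show ?thesis by (rule good_mono) auto
  qed
  \<comment> \<open>The admissible ratio grows by \<open>d\<close> per step up to the cap
    \<open>\<beta> + 1\<close>. For ratio 1, \<open>f y = 0\<close> and the state lies in
    \<open>S\<close>.\<close>
  have G_good: "good (G (min (1 + real n * d) (\<beta> + 1)))" for n
  proof (induction n)
    case 0
    have "G 1 \<subseteq> S"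
    proof clarify
      fix y q assume yq: "(y, q) \<in> G 1"
      then have q: "0 < q" "0 < q + (f y)\<^sup>2" using q0_pos by (auto simp: G_def add_pos_nonneg)
      then have "(f y)\<^sup>2 \<le> 0" using yq by (simp add: G_def)
      then show "(y, q) \<in> S" using yq R(1) by (simp add: S_def G_def scale_def)
    qed
    then show ?case using \<beta> good_mono[OF S_good] by simp
  next
    case (Suc n)
    define u where "u = min (1 + real n * d) (\<beta> + 1)"
    define u' where "u' = min (1 + real (Suc n) * d) (\<beta> + 1)"
    have u: "0 < u'" "u' \<le> \<beta> + 1" "u' - d \<le> u"
      using d \<beta> by (auto simp: u_def u'_def distrib_right add_pos_nonneg)
    have "good (G u')"
    proof (rule pass)
      show "good (G u)" using Suc by (simp add: u_def)
      fix y q assume yq: "(y, q) \<in> G u'"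
      then show q: "q0 \<le> q" by (simp add: G_def)
      fix b assume big: "R < scale f y q" and b: "b \<in> hits (scale f y q)"
      define l where "l = ln (q + (f y)\<^sup>2)"
      have pos: "0 < q" using q q0_pos by linarith
      have "\<Lambda> \<le> ln q" using yq by (simp add: G_def)
      also have "ln q \<le> l" unfolding l_def by (rule ln_mono) (use pos in auto)
      finally have l: "\<Lambda> \<le> l" .
      have "l \<le> u' * ln q" using yq by (simp add: G_def l_def)
      then have "l / u' \<le> ln q" using u(1) by (simp add: field_simps)
      then have "\<beta> * (l - ln q) \<le> \<beta> * (l - l / u')" using \<beta> by (intro mult_left_mono) auto
      also have "\<dots> = (\<beta> - \<beta> / u') * l" by (simp add: algebra_simps)
      also have "\<dots> \<le> (u' - 2 * d) * l"
      proof (intro mult_right_mono)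
        have "2 * d * u' \<le> 2 * d * (\<beta> + 1)" using u d by (intro mult_left_mono) auto
        also have "\<dots> = \<beta> - \<beta>\<^sup>2 / 4"
        proof -
          have "\<beta> + 1 \<noteq> 0" using \<beta> by linarith
          then show ?thesis
            unfolding d_def by (metis (no_types, opaque_lifting) field_sum_of_halves mult_2
                nonzero_divide_eq_eq distrib_right)
        qed
        also have "\<dots> \<le> u' * u' - \<beta> * u' + \<beta>"
          using zero_le_power2[of "u' - \<beta> / 2"] by (simp add: power2_diff power2_eq_square algebra_simps)
        finally show "\<beta> - \<beta> / u' \<le> u' - 2 * d" using u(1) by (simp add: field_simps)
        show "0 \<le> l" using l \<Lambda>(1) by linarith
      qed
      finally have "C + \<beta> * (l - ln q) \<le> d * \<Lambda> + (u' - 2 * d) * l" using \<Lambda>(2) by linarith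
      also have "\<dots> \<le> d * l + (u' - 2 * d) * l" using l d by simp
      also have "\<dots> = (u' - d) * l" by (simp add: algebra_simps)
      also have "\<dots> \<le> u * l" using u(3) l \<Lambda>(1) by (intro mult_right_mono) auto
      finally have le: "C + \<beta> * (l - ln q) \<le> u * l" .
      have "q0 \<le> q + (f y)\<^sup>2" using q by (simp add: add_increasing2)
      then show "(b, q + (f y)\<^sup>2) \<in> S \<union> G u"
        using hit_ln[OF q big b] le l by (auto simp: S_def G_def l_def)
    qed
    then show ?case by (simp add: u'_def)
  qed
  \<comment> \<open>Enough steps to reach the cap. From an arbitrary state outside \<open>S\<close>,
    one hit leads into \<open>S \<union> G (\<beta> + 1)\<close>, because
    \<open>C - \<beta> * ln q0 \<le> \<Lambda>\<close>.\<close>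
  obtain n where "\<beta> / d \<le> real n" using real_arch_simple by blast
  then have "\<beta> + 1 \<le> 1 + real n * d" using d by (simp add: field_simps)
  then have "min (1 + real n * d) (\<beta> + 1) = \<beta> + 1" by (rule min_absorb2)
  then have "good (G (\<beta> + 1))" using G_good[of n] by (simp only:)
  then show ?thesis
  proof (rule pass)
    fix y q b assume "(y, q) \<in> {(y, q). q0 \<le> q}" and big: "R < scale f y q"
      and b: "b \<in> hits (scale f y q)"
    then have q: "q0 \<le> q" by simp
    then have pos: "0 < q" using q0_pos by linarith
    define l where "l = ln (q + (f y)\<^sup>2)"
    have "\<Lambda> \<le> l"
    proof -
      have "sqrt (exp \<Lambda> / q0) \<le> scale f y q" using R(3) big by linarith
      then have "exp \<Lambda> / q0 \<le> (scale f y q)\<^sup>2" by (rule sqrt_le_D)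
      then have "exp \<Lambda> \<le> q0 * (1 + (f y)\<^sup>2 / q)"
        using pos q0_pos by (simp add: scale_square field_simps)
      also have "\<dots> \<le> q * (1 + (f y)\<^sup>2 / q)" using q pos by (intro mult_right_mono) auto
      also have "\<dots> = q + (f y)\<^sup>2" using pos by (simp add: field_simps)
      finally have "exp \<Lambda> \<le> q + (f y)\<^sup>2" .
      then show ?thesis unfolding l_def using pos by (subst ln_ge_iff) (auto simp: add_pos_nonneg)
    qed
    moreover have "C + \<beta> * (l - ln q) \<le> (\<beta> + 1) * l"
    proof -
      have "\<beta> * ln q0 \<le> \<beta> * ln q" using \<beta> q q0_pos by (intro mult_left_mono) auto
      then show ?thesis using \<open>\<Lambda> \<le> l\<close> \<Lambda>(3) by (simp add: algebra_simps)
    qed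
    moreover have "q0 \<le> q + (f y)\<^sup>2" using q by (simp add: add_increasing2)
    ultimately show "(b, q + (f y)\<^sup>2) \<in> S \<union> G (\<beta> + 1)"
      using hit_ln[OF q big b] by (auto simp: S_def G_def l_def)
  qed auto
qed

end

text \<open>For large \<open>\<sigma>\<close> the growth set fills a fixed fraction of
  \<open>{-\<sigma>..\<sigma>}\<close>, where the Gaussian density is at least a constant over
  \<open>\<sigma>\<close>. Away from \<open>{-1..1}\<close> the exponent may be raised to
  \<open>\<beta>\<close>.\<close>

lemma gauss_growth_set_ge:
  assumes [measurable]: "f \<in> borel_measurable borel" and L: "0 < L" and b: "b \<le> \<beta>"
    and dens: "Liminf at_top (\<lambda>l::real. ereal (measure lebesgue (growth_set f b L \<inter> {-l..l}) / l)) > 0"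
  shows "\<exists>r>0. \<exists>R0. \<forall>\<sigma>\<ge>R0.
      r \<le> measure (gauss \<sigma>) {x. 1 \<le> \<bar>x\<bar> \<and> \<bar>x\<bar> \<le> \<sigma> \<and> \<bar>f x\<bar> < L * \<bar>x\<bar> powr \<beta>}"
proof -
  obtain c where c: "0 < ereal c"
    "ereal c < Liminf at_top (\<lambda>l::real. ereal (measure lebesgue (growth_set f b L \<inter> {-l..l}) / l))"
    using ereal_dense2[OF dens] by blast
  then have "\<forall>\<^sub>F l in at_top. ereal c < ereal (measure lebesgue (growth_set f b L \<inter> {-l..l}) / l)"
    by (intro less_LiminfD)
  then obtain l0 where l0: "\<And>l. l0 \<le> l \<Longrightarrow> c < measure lebesgue (growth_set f b L \<inter> {-l..l}) / l"
    by (auto simp: eventually_at_top_linorder)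
  have c0: "0 < c" using c by simp
  define A where "A \<sigma> = {x. 1 \<le> \<bar>x\<bar> \<and> \<bar>x\<bar> \<le> \<sigma> \<and> \<bar>f x\<bar> < L * \<bar>x\<bar> powr \<beta>}" for \<sigma>
  have A_sets [measurable]: "A \<sigma> \<in> sets borel" for \<sigma>
  proof -
    have "{x \<in> space borel. 1 \<le> \<bar>x\<bar> \<and> \<bar>x\<bar> \<le> \<sigma> \<and> \<bar>f x\<bar> < L * \<bar>x\<bar> powr \<beta>} \<in> sets borel"
      by measurable
    then show ?thesis by (simp add: A_def)
  qed
  define r where "r = exp (- 1\<^sup>2 / 2) / sqrt (2 * pi) * (c / 2)"
  \<comment> \<open>The bound \<open>4 / c\<close> ensures that discarding \<open>{-1..1}\<close>,
    of measure 2, costs at most half of \<open>c * \<sigma>\<close>.\<close>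
  have "r \<le> measure (gauss \<sigma>) (A \<sigma>)" if \<sigma>: "max 1 (max l0 (4 / c)) \<le> \<sigma>" for \<sigma>
  proof -
    have \<sigma>': "1 \<le> \<sigma>" "l0 \<le> \<sigma>" "4 / c \<le> \<sigma>" using \<sigma> by auto
    have gs: "growth_set f b L \<in> sets borel"
    proof -
      have "{x \<in> space borel. \<bar>f x\<bar> < L * \<bar>x\<bar> powr b} \<in> sets borel" by measurable
      then show ?thesis by (simp add: growth_set_def)
    qed
    have "growth_set f b L \<inter> {-\<sigma>..\<sigma>} \<subseteq> A \<sigma> \<union> {-1..1}"
    proof
      fix x assume x: "x \<in> growth_set f b L \<inter> {-\<sigma>..\<sigma>}"
      show "x \<in> A \<sigma> \<union> {-1..1}"
      proof (cases "\<bar>x\<bar> \<le> 1")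
        case False
        then have "L * \<bar>x\<bar> powr b \<le> L * \<bar>x\<bar> powr \<beta>"
          using L b by (intro mult_left_mono powr_mono) auto
        then show ?thesis using x False by (auto simp: growth_set_def A_def)
      qed auto
    qed
    moreover have bounded: "A \<sigma> \<union> {-1..1} \<subseteq> {-\<sigma>..\<sigma>}" using \<sigma>' by (auto simp: A_def)
    then have fin: "emeasure lborel (A \<sigma> \<union> {-1..1}) < \<infinity>"
      using emeasure_mono[OF bounded, of lborel] by (simp add: emeasure_lborel_Icc_eq le_less_trans split: if_splits)
    ultimately have "measure lborel (growth_set f b L \<inter> {-\<sigma>..\<sigma>}) \<le> measure lborel (A \<sigma> \<union> {-1..1})"
      using gs by (intro measure_mono_fmeasurable) (auto simp: fmeasurable_def)
    also have "\<dots> \<le> measure lborel (A \<sigma>) + measure lborel {-1..1::real}"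
      by (rule measure_Un_le) auto
    finally have "c * \<sigma> \<le> measure lborel (A \<sigma>) + 2"
      using l0[OF \<sigma>'(2)] \<sigma>'(1) gs by (simp add: field_simps)
    moreover have "4 \<le> c * \<sigma>" using \<sigma>'(3) c0 by (simp add: field_simps)
    ultimately have "c / 2 * \<sigma> \<le> measure lborel (A \<sigma>)" by linarith
    then have "r \<le> exp (- 1\<^sup>2 / 2) / (sqrt (2 * pi) * \<sigma>) * measure lborel (A \<sigma>)"
      using \<sigma>'(1) by (simp add: r_def field_simps)
    also have "\<dots> \<le> measure (gauss \<sigma>) (A \<sigma>)"
      by (rule gauss_ge) (use \<sigma>' in \<open>auto simp: A_def\<close>)
    finally show ?thesis .
  qed
  moreover have "0 < r" using c0 by (simp add: r_def)
  ultimately show ?thesis unfolding A_def by blast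
qed

section \<open>The posterior distribution of the parameter\<close>

text \<open>Bayes' rule for a Gaussian prior of mean \<open>m\<close> and precision \<open>q\<close>
  and an observation \<open>b\<close> of mean \<open>(a - m) * F\<close>: completing the square in
  \<open>a\<close> factors the joint density into the predictive density of \<open>b\<close> and the
  posterior density of \<open>a\<close>.\<close>

lemma normal_density_update:
  fixes q F a b m :: real
  assumes q: "0 < q"
  shows "normal_density ((a - m) * F) 1 b * normal_density m (1 / sqrt q) a
    = normal_density 0 (sqrt (1 + F\<^sup>2 / q)) b
      * normal_density (m + F * b / (q + F\<^sup>2)) (1 / sqrt (q + F\<^sup>2)) a"
proof -
  have nd: "normal_density \<mu> (1 / sqrt r) x = sqrt r / sqrt (2 * pi) * exp (- r * (x - \<mu>)\<^sup>2 / 2)"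
    if "0 < r" for \<mu> r x :: real
    using that by (simp add: normal_density_def power_divide real_sqrt_divide)
  have q': "0 < q + F\<^sup>2" using q by (simp add: add_pos_nonneg)
  have s: "sqrt (1 + F\<^sup>2 / q) = 1 / sqrt (q / (q + F\<^sup>2))"
  proof -
    have "1 + F\<^sup>2 / q = 1 / (q / (q + F\<^sup>2))" using q q' by (simp add: field_simps)
    then show ?thesis by (simp add: real_sqrt_divide del: divide_divide_eq_right)
  qed
  define d where "d = a - m"
  have quad: "(b - d * F)\<^sup>2 + q * d\<^sup>2
      = q / (q + F\<^sup>2) * b\<^sup>2 + (q + F\<^sup>2) * (d - F * b / (q + F\<^sup>2))\<^sup>2"
  proof -
    \<comment> \<open>Eliminating \<open>q\<close> as \<open>z - F^2\<close> makes the claim,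
      multiplied by \<open>z\<close>, a polynomial identity.\<close>
    define z where "z = q + F\<^sup>2"
    have z: "z \<noteq> 0" "q = z - F\<^sup>2" using q' by (auto simp: z_def)
    have "z * ((b - d * F)\<^sup>2 + (z - F\<^sup>2) * d\<^sup>2) = (z - F\<^sup>2) * b\<^sup>2 + (z * d - F * b)\<^sup>2"
      by (simp add: power2_eq_square algebra_simps)
    also have "\<dots> = z * ((z - F\<^sup>2) / z * b\<^sup>2 + z * (d - F * b / z)\<^sup>2)"
      using z(1) by (simp add: power2_eq_square field_simps)
    finally show ?thesis using z unfolding z_def[symmetric] by simp
  qed
  have "normal_density (d * F) 1 b * normal_density m (1 / sqrt q) a
      = sqrt q / (sqrt (2 * pi) * sqrt (2 * pi)) * exp (- ((b - d * F)\<^sup>2 + q * d\<^sup>2) / 2)"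
    using nd[of 1 "d * F" b] nd[OF q, of m a]
    by (simp add: d_def mult_exp_exp add_divide_distrib)
  also have "\<dots> = sqrt (q / (q + F\<^sup>2)) * sqrt (q + F\<^sup>2) / (sqrt (2 * pi) * sqrt (2 * pi))
      * exp (- (q / (q + F\<^sup>2) * b\<^sup>2 + (q + F\<^sup>2) * (d - F * b / (q + F\<^sup>2))\<^sup>2) / 2)"
    using q' by (simp only: quad) (simp add: real_sqrt_divide)
  also have "\<dots> = (sqrt (q / (q + F\<^sup>2)) / sqrt (2 * pi) * exp (- (q / (q + F\<^sup>2)) * b\<^sup>2 / 2))
      * (sqrt (q + F\<^sup>2) / sqrt (2 * pi) * exp (- (q + F\<^sup>2) * (d - F * b / (q + F\<^sup>2))\<^sup>2 / 2))"
  proof -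
    have split: "exp (- (r + s) / 2) = exp (- r / 2) * exp (- s / 2)" for r s :: real
      by (simp add: add_divide_distrib diff_divide_distrib flip: exp_add)
    show ?thesis
      by (simp only: split mult_minus_left) (simp add: mult_ac)
  qed
  also have "\<dots> = normal_density 0 (sqrt (1 + F\<^sup>2 / q)) b
      * normal_density (m + F * b / (q + F\<^sup>2)) (1 / sqrt (q + F\<^sup>2)) a"
  proof -
    have "0 < q / (q + F\<^sup>2)" using q q' by simp
    then show ?thesis
      unfolding s by (subst nd, simp, subst nd[OF q']) (simp add: d_def diff_diff_eq)
  qed
  finally show ?thesis by (simp add: d_def)
qed

text \<open>The posterior mean in recursive least-squares form. The output \<open>p (Suc i)\<close>
  itself serves as the innovation because the control removes its predicted mean; the gain uses the
  updated precision.\<close>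

definition estimate :: "(real \<Rightarrow> real) \<Rightarrow> real \<Rightarrow> real \<Rightarrow> nat \<Rightarrow> (nat \<Rightarrow> real) \<Rightarrow> real" where
  "estimate f m0 q0 t p = m0 + (\<Sum>i<t. f (p i) * p (Suc i) / info f q0 (Suc i) p)"

lemma estimate_cong: "(\<And>i. i \<le> t \<Longrightarrow> p i = p' i) \<Longrightarrow> estimate f m0 q0 t p = estimate f m0 q0 t p'"
proof -
  assume eq: "\<And>i. i \<le> t \<Longrightarrow> p i = p' i"
  have "f (p i) * p (Suc i) / info f q0 (Suc i) p = f (p' i) * p' (Suc i) / info f q0 (Suc i) p'"
    if "i < t" for i
    using that eq[of i] eq[of "Suc i"] info_cong[of "Suc i" p p' f q0] eq by simp
  then show ?thesis unfolding estimate_def by simp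
qed

lemma estimate_Suc_upd:
  "estimate f m0 q0 (Suc t) (p(Suc t := b))
    = estimate f m0 q0 t p + f (p t) * b / (info f q0 t p + (f (p t))\<^sup>2)"
proof -
  have "estimate f m0 q0 t (p(Suc t := b)) = estimate f m0 q0 t p"
    by (rule estimate_cong) auto
  then show ?thesis by (simp add: estimate_def info_Suc)
qed

lemma measurable_estimate [measurable]:
  assumes [measurable]: "f \<in> borel_measurable borel"
  shows "estimate f m0 q0 t \<in> borel_measurable path_space"
  unfolding estimate_def[abs_def] by measurable

definition control :: "(real \<Rightarrow> real) \<Rightarrow> real \<Rightarrow> real \<Rightarrow> nat \<Rightarrow> (nat \<Rightarrow> real) \<Rightarrow> real" where
  "control f m0 q0 t p = - estimate f m0 q0 t p * f (p t)"

lemma feedback_law_control: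
  assumes f: "f \<in> borel_measurable borel"
  shows "feedback_law (control f m0 q0)"
  unfolding feedback_law_def
proof
  fix t
  let ?N = "generated UNIV ((\<lambda>i p. p i) ` {..t}) :: (nat \<Rightarrow> real) measure"
  have comp: "(\<lambda>p. p i) \<in> borel_measurable ?N" if "i \<le> t" for i
  proof (rule measurableI)
    fix A :: "real set" assume "A \<in> sets borel"
    then have "(\<lambda>p. p i) -` A \<inter> UNIV \<in> {X -` A \<inter> UNIV | X A. X \<in> (\<lambda>i p. p i) ` {..t} \<and> A \<in> sets borel}"
      using that by blast
    then show "(\<lambda>p. p i) -` A \<inter> space ?N \<in> sets ?N"
      unfolding sets_generated space_generated by (rule sigma_sets.Basic)
  qed simp
  have fcomp: "(\<lambda>p. f (p i)) \<in> borel_measurable ?N" if "i \<le> t" for i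
    using measurable_compose[OF comp[OF that] f] .
  \<comment> \<open>\<open>info f q0 s\<close> reads only coordinates below \<open>s\<close>, so
    even \<open>s = Suc t\<close> is known at time \<open>t\<close>.\<close>
  have inf: "info f q0 s \<in> borel_measurable ?N" if "s \<le> Suc t" for s
    unfolding info_def[abs_def]
    by (intro borel_measurable_add borel_measurable_const borel_measurable_sum borel_measurable_power fcomp)
       (use that in auto)
  have "(\<lambda>p. \<Sum>i<t. f (p i) * p (Suc i) / info f q0 (Suc i) p) \<in> borel_measurable ?N"
    by (intro borel_measurable_sum borel_measurable_divide borel_measurable_times fcomp comp inf) auto
  then show "control f m0 q0 t \<in> borel_measurable ?N"
    unfolding control_def[abs_def] estimate_def
    by (intro borel_measurable_times borel_measurable_uminus borel_measurable_add
        borel_measurable_const fcomp) auto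
qed

section \<open>Independence and the joint law of outputs and parameter\<close>

lemma (in prob_space) nn_integral_indep_var:
  assumes ind: "indep_var S Z T V" and g: "g \<in> borel_measurable (S \<Otimes>\<^sub>M T)"
  shows "(\<integral>\<^sup>+\<omega>. g (Z \<omega>, V \<omega>) \<partial>M) = (\<integral>\<^sup>+\<omega>. \<integral>\<^sup>+\<omega>'. g (Z \<omega>, V \<omega>') \<partial>M \<partial>M)"
proof -
  have Z: "Z \<in> measurable M S" and V: "V \<in> measurable M T"
    and eq: "distr M S Z \<Otimes>\<^sub>M distr M T V = distr M (S \<Otimes>\<^sub>M T) (\<lambda>x. (Z x, V x))"
    using ind[unfolded indep_var_distribution_eq] by auto
  interpret V: prob_space "distr M T V" by (rule prob_space_distr[OF V])
  have g': "g \<in> borel_measurable (S \<Otimes>\<^sub>M distr M T V)"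
    using g by (simp cong: measurable_cong_sets)
  have "(\<integral>\<^sup>+\<omega>. g (Z \<omega>, V \<omega>) \<partial>M) = (\<integral>\<^sup>+x. g x \<partial>distr M (S \<Otimes>\<^sub>M T) (\<lambda>x. (Z x, V x)))"
    using g Z V by (subst nn_integral_distr) auto
  also have "\<dots> = (\<integral>\<^sup>+x. g x \<partial>(distr M S Z \<Otimes>\<^sub>M distr M T V))"
    by (simp add: eq)
  also have "\<dots> = (\<integral>\<^sup>+z. \<integral>\<^sup>+v. g (z, v) \<partial>distr M T V \<partial>distr M S Z)"
    by (rule V.nn_integral_fst[symmetric]) (use g in \<open>simp cong: measurable_cong_sets\<close>)
  also have "\<dots> = (\<integral>\<^sup>+\<omega>. \<integral>\<^sup>+v. g (Z \<omega>, v) \<partial>distr M T V \<partial>M)"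
    using V.borel_measurable_nn_integral_fst[OF g'] by (subst nn_integral_distr[OF Z]) auto
  also have "\<dots> = (\<integral>\<^sup>+\<omega>. \<integral>\<^sup>+\<omega>'. g (Z \<omega>, V \<omega>') \<partial>M \<partial>M)"
    using measurable_space[OF Z] g
    by (intro nn_integral_cong nn_integral_distr[OF V]) (auto intro: measurable_Pair2)
  finally show ?thesis .
qed

text \<open>The sequence \<open>X\<close> lists all independent sources: initial value, parameter,
  then the noise, with \<open>w n\<close> at index \<open>n + 1\<close>. The outputs up to time
  \<open>t\<close> are determined by the sources of index at most \<open>t + 1\<close>.\<close>

locale self_tuning = prob_space M for M :: "'a measure" +
  fixes f :: "real \<Rightarrow> real" and \<theta> :: "'a \<Rightarrow> real" and w y :: "nat \<Rightarrow> 'a \<Rightarrow> real" and m0 q0 :: real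
    and X :: "nat \<Rightarrow> 'a \<Rightarrow> real"
  defines "X \<equiv> \<lambda>n. if n = 0 then y 0 else if n = 1 then \<theta> else w (n - 1)"
  assumes f_meas [measurable]: "f \<in> borel_measurable borel" and q0: "0 < q0"
    and indep: "indep_vars (\<lambda>_. borel) X UNIV"
    and \<theta>_normal: "distributed M lborel \<theta> (normal_density m0 (1 / sqrt q0))"
    and w_normal: "\<And>t. 1 \<le> t \<Longrightarrow> distributed M lborel (w t) (normal_density 0 1)"
    and loop: "closed_loop M f \<theta> w (control f m0 q0) y"
begin

abbreviation Y :: "'a \<Rightarrow> nat \<Rightarrow> real" where "Y \<omega> \<equiv> \<lambda>i. y i \<omega>"

text \<open>The closed-loop path as an explicit function of the sources, from which independence of
  the past and the next noise is derived. Coordinates beyond the current time hold the default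
  \<open>x 0\<close>.\<close>

primrec traj :: "(nat \<Rightarrow> real) \<Rightarrow> nat \<Rightarrow> nat \<Rightarrow> real" where
  "traj x 0 = (\<lambda>_. x 0)"
| "traj x (Suc t) = (traj x t)(Suc t := x 1 * f (traj x t t) + control f m0 q0 t (traj x t) + x (Suc (Suc t)))"

lemma measurable_control [measurable]: "control f m0 q0 t \<in> borel_measurable path_space"
  unfolding control_def[abs_def] by measurable

lemma control_cong: "(\<And>i. i \<le> t \<Longrightarrow> p i = p' i) \<Longrightarrow> control f m0 q0 t p = control f m0 q0 t p'"
  unfolding control_def using estimate_cong[of t p p'] by simp

lemma measurable_traj: "{..Suc t} \<subseteq> J \<Longrightarrow> (\<lambda>x. traj x t) \<in> measurable (PiM J (\<lambda>_. borel)) path_space"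
proof (induction t)
  case 0
  then have "0 \<in> J" by auto
  then show ?case by (auto intro!: measurable_PiM_single' simp: space_PiM)
next
  case (Suc t)
  then have [measurable]: "(\<lambda>x. traj x t) \<in> measurable (PiM J (\<lambda>_. borel)) path_space"
    by (intro Suc.IH) auto
  have "1 \<in> J" "Suc (Suc t) \<in> J" using Suc.prems by auto
  then have [measurable]: "(\<lambda>x. x 1) \<in> borel_measurable (PiM J (\<lambda>_. borel))"
    "(\<lambda>x. x (Suc (Suc t))) \<in> borel_measurable (PiM J (\<lambda>_. borel))"
    by (auto intro!: measurable_component_singleton)
  have [measurable]: "(\<lambda>x. traj x t t) \<in> borel_measurable (PiM J (\<lambda>_. borel))"
    by measurable
  show ?case unfolding traj.simps by measurable
qed

lemma traj_eq:
  assumes \<omega>: "\<omega> \<in> space M" and x: "\<And>n. n \<le> Suc t \<Longrightarrow> x n = X n \<omega>" and i: "i \<le> t"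
  shows "traj x t i = y i \<omega>"
  using x i
proof (induction t arbitrary: i)
  case 0
  then show ?case by (simp add: X_def)
next
  case (Suc t)
  have IH: "traj x t i = y i \<omega>" if "i \<le> t" for i
    using Suc.IH[of i] Suc.prems that by simp
  have "control f m0 q0 t (traj x t) = control f m0 q0 t (Y \<omega>)"
    by (rule control_cong) (rule IH)
  moreover have "y (Suc t) \<omega> = \<theta> \<omega> * f (y t \<omega>) + control f m0 q0 t (Y \<omega>) + w (Suc t) \<omega>"
    using loop \<omega> unfolding closed_loop_def by blast
  moreover have "x 1 = \<theta> \<omega>" "x (Suc (Suc t)) = w (Suc t) \<omega>"
    using Suc.prems(1) by (auto simp: X_def)
  ultimately show ?case using Suc.prems(2) IH by (auto simp: le_Suc_eq)
qed

lemma X_measurable [measurable]: "X n \<in> borel_measurable M"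
  using indep by (auto simp: indep_vars_def)

lemma Y_measurable [measurable]: "Y \<in> measurable M path_space"
proof (rule measurable_PiM_single')
  fix i
  have "(\<lambda>\<omega> n. X n \<omega>) \<in> measurable M path_space"
    by (rule measurable_PiM_single') (auto simp: space_PiM)
  from measurable_compose[OF this measurable_traj[of i UNIV]]
  have [measurable]: "(\<lambda>\<omega>. traj (\<lambda>n. X n \<omega>) i) \<in> measurable M path_space" by simp
  have "(\<lambda>\<omega>. traj (\<lambda>n. X n \<omega>) i i) \<in> borel_measurable M" by measurable
  then show "y i \<in> borel_measurable M"
    by (rule measurable_cong[THEN iffD1, rotated]) (simp add: traj_eq)
qed (auto simp: space_PiM)

lemma \<theta>_measurable [measurable]: "\<theta> \<in> borel_measurable M"
  using X_measurable[of 1] by (simp add: X_def)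

text \<open>\<open>w (Suc t)\<close> is the source of index \<open>t + 2\<close>, independent of
  those up to \<open>t + 1\<close>, which determine the path and the parameter; so the noise can be
  integrated out first.\<close>

lemma nn_integral_noise:
  assumes g [measurable]: "g \<in> borel_measurable ((path_space \<Otimes>\<^sub>M borel) \<Otimes>\<^sub>M borel)"
  shows "(\<integral>\<^sup>+\<omega>. g ((traj (restrict (\<lambda>n. X n \<omega>) {..Suc t}) t, \<theta> \<omega>), w (Suc t) \<omega>) \<partial>M)
    = (\<integral>\<^sup>+\<omega>. \<integral>\<^sup>+b. ennreal (normal_density 0 1 b)
        * g ((traj (restrict (\<lambda>n. X n \<omega>) {..Suc t}) t, \<theta> \<omega>), b) \<partial>lborel \<partial>M)"
proof -
  have ind: "indep_var (PiM {..Suc t} (\<lambda>_. borel)) (\<lambda>\<omega>. restrict (\<lambda>n. X n \<omega>) {..Suc t})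
      (PiM {Suc (Suc t)} (\<lambda>_. borel)) (\<lambda>\<omega>. restrict (\<lambda>n. X n \<omega>) {Suc (Suc t)})"
    by (rule indep_var_restrict[OF indep]) auto
  have [measurable]: "(\<lambda>x. (traj x t, x 1)) \<in> measurable (PiM {..Suc t} (\<lambda>_. borel)) (path_space \<Otimes>\<^sub>M borel)"
    by (intro measurable_Pair measurable_traj measurable_component_singleton) auto
  have [measurable]: "(\<lambda>x. x (Suc (Suc t))) \<in> measurable (PiM {Suc (Suc t)} (\<lambda>_. borel)) borel"
    by (intro measurable_component_singleton) auto
  have X1: "X 1 \<omega> = \<theta> \<omega>" and X2: "X (Suc (Suc t)) \<omega> = w (Suc t) \<omega>" for \<omega>
    by (auto simp: X_def)
  have "(\<lambda>(x, v). g ((traj x t, x 1), v (Suc (Suc t))))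
      \<in> borel_measurable (PiM {..Suc t} (\<lambda>_. borel) \<Otimes>\<^sub>M PiM {Suc (Suc t)} (\<lambda>_. borel))"
    by measurable
  from nn_integral_indep_var[OF ind this]
  have "(\<integral>\<^sup>+\<omega>. g ((traj (restrict (\<lambda>n. X n \<omega>) {..Suc t}) t, \<theta> \<omega>), w (Suc t) \<omega>) \<partial>M)
    = (\<integral>\<^sup>+\<omega>. \<integral>\<^sup>+\<omega>'. g ((traj (restrict (\<lambda>n. X n \<omega>) {..Suc t}) t, \<theta> \<omega>), w (Suc t) \<omega>') \<partial>M \<partial>M)"
    by (simp add: X1[simplified] X2)
  also have "\<dots> = (\<integral>\<^sup>+\<omega>. \<integral>\<^sup>+b. ennreal (normal_density 0 1 b)
        * g ((traj (restrict (\<lambda>n. X n \<omega>) {..Suc t}) t, \<theta> \<omega>), b) \<partial>lborel \<partial>M)"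
  proof (rule nn_integral_cong)
    fix \<omega>
    have "(\<lambda>b. g ((traj (restrict (\<lambda>n. X n \<omega>) {..Suc t}) t, \<theta> \<omega>), b)) \<in> borel_measurable borel"
      by (rule measurable_Pair2[OF g]) (auto simp: space_PiM space_pair_measure)
    then show "(\<integral>\<^sup>+\<omega>'. g ((traj (restrict (\<lambda>n. X n \<omega>) {..Suc t}) t, \<theta> \<omega>), w (Suc t) \<omega>') \<partial>M)
        = (\<integral>\<^sup>+b. ennreal (normal_density 0 1 b)
          * g ((traj (restrict (\<lambda>n. X n \<omega>) {..Suc t}) t, \<theta> \<omega>), b) \<partial>lborel)"
      by (intro distributed_nn_integral[OF w_normal, symmetric]) auto
  qed
  finally show ?thesis .
qed

definition posterior :: "nat \<Rightarrow> (nat \<Rightarrow> real) \<Rightarrow> real \<Rightarrow> real" where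
  "posterior t p = normal_density (estimate f m0 q0 t p) (1 / sqrt (info f q0 t p))"

lemma posterior_measurable [measurable]:
  "(\<lambda>(p, a). posterior t p a) \<in> borel_measurable (path_space \<Otimes>\<^sub>M borel)"
  unfolding posterior_def normal_density_def by measurable

text \<open>Integrated form of the claim that \<open>posterior t\<close> is the conditional density
  of the parameter given the outputs up to time \<open>t\<close>; hence test functions read the path
  only up to that time.\<close>

definition posterior_at :: "nat \<Rightarrow> bool" where
  "posterior_at t \<longleftrightarrow> (\<forall>g. g \<in> borel_measurable (path_space \<Otimes>\<^sub>M borel) \<longrightarrow> (\<forall>a. adapted t (\<lambda>p. g (p, a))) \<longrightarrow>
     (\<integral>\<^sup>+\<omega>. g (Y \<omega>, \<theta> \<omega>) \<partial>M) = (\<integral>\<^sup>+\<omega>. \<integral>\<^sup>+a. g (Y \<omega>, a) * ennreal (posterior t (Y \<omega>) a) \<partial>lborel \<partial>M))"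

text \<open>Given the parameter and the past, the next output is Gaussian. Averaging over the
  posterior and rearranging the product of densities by \<open>normal_density_update\<close> exposes
  the predictive law and the new posterior.\<close>

lemma predict:
  assumes post: "posterior_at t" and g [measurable]: "g \<in> borel_measurable (path_space \<Otimes>\<^sub>M borel)"
    and ad: "\<And>a. adapted (Suc t) (\<lambda>p. g (p, a))"
  shows "(\<integral>\<^sup>+\<omega>. g (Y \<omega>, \<theta> \<omega>) \<partial>M)
    = (\<integral>\<^sup>+\<omega>. \<integral>\<^sup>+b. (\<integral>\<^sup>+a. g ((Y \<omega>)(Suc t := b), a) * ennreal (posterior (Suc t) ((Y \<omega>)(Suc t := b)) a) \<partial>lborel)
        \<partial>gauss (scale f (y t \<omega>) (info f q0 t (Y \<omega>))) \<partial>M)"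
proof -
  \<comment> \<open>A function of the sources up to index \<open>t + 1\<close> replaces the path,
    with which it agrees up to time \<open>t\<close>; the next noise is independent of it.\<close>
  define Z where "Z \<omega> = traj (restrict (\<lambda>n. X n \<omega>) {..Suc t}) t" for \<omega>
  have Z: "Z \<omega> i = y i \<omega>" if "\<omega> \<in> space M" "i \<le> t" for \<omega> i
    unfolding Z_def using that by (intro traj_eq) auto
  \<comment> \<open>Mean of the next output when the parameter is \<open>a\<close>: the control
    leaves only the estimation error times \<open>f (p t)\<close>.\<close>
  define c where "c p a = (a - estimate f m0 q0 t p) * f (p t)" for p and a :: real
  have [measurable]: "(\<lambda>(p, a). c p a) \<in> borel_measurable (path_space \<Otimes>\<^sub>M borel)"
    unfolding c_def by measurable
  have c_cong: "c p a = c p' a" if "\<And>i. i \<le> t \<Longrightarrow> p i = p' i" for p p' a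
    unfolding c_def using estimate_cong[of t p p'] that by simp
  define k where "k = (\<lambda>(p, a). \<integral>\<^sup>+b. g (p(Suc t := b), a) * ennreal (normal_density (c p a) 1 b) \<partial>lborel)"
  have k_meas [measurable]: "k \<in> borel_measurable (path_space \<Otimes>\<^sub>M borel)"
    unfolding k_def normal_density_def by measurable
  have k_ad: "adapted t (\<lambda>p. k (p, a))" for a
    unfolding adapted_def
  proof (intro allI impI)
    fix p p' :: "nat \<Rightarrow> real" assume eq: "\<forall>i\<le>t. p i = p' i"
    have "g (p(Suc t := b), a) = g (p'(Suc t := b), a)" for b
      by (rule adaptedD[OF ad]) (use eq in \<open>auto simp: le_Suc_eq\<close>)
    moreover have "c p a = c p' a" by (rule c_cong) (use eq in auto)
    ultimately show "k (p, a) = k (p', a)" by (simp add: k_def)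
  qed
  have shift: "(\<integral>\<^sup>+b. h (c + b) * ennreal (normal_density 0 1 b) \<partial>lborel)
      = (\<integral>\<^sup>+b. h b * ennreal (normal_density c 1 b) \<partial>lborel)"
    if [measurable]: "h \<in> borel_measurable borel" for h :: "real \<Rightarrow> ennreal" and c
    by (subst (2) nn_integral_real_affine[of _ 1 c]) (auto simp: normal_density_def)
  have g1: "(\<lambda>x. g ((fst (fst x))(Suc t := c (fst (fst x)) (snd (fst x)) + snd x), snd (fst x)))
      \<in> borel_measurable ((path_space \<Otimes>\<^sub>M borel) \<Otimes>\<^sub>M borel)"
    by measurable
  have "(\<integral>\<^sup>+\<omega>. g (Y \<omega>, \<theta> \<omega>) \<partial>M) = (\<integral>\<^sup>+\<omega>. g ((Z \<omega>)(Suc t := c (Z \<omega>) (\<theta> \<omega>) + w (Suc t) \<omega>), \<theta> \<omega>) \<partial>M)"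
  proof (rule nn_integral_cong)
    fix \<omega> assume \<omega>: "\<omega> \<in> space M"
    have "y (Suc t) \<omega> = \<theta> \<omega> * f (y t \<omega>) + control f m0 q0 t (Y \<omega>) + w (Suc t) \<omega>"
      using loop \<omega> unfolding closed_loop_def by blast
    also have "\<theta> \<omega> * f (y t \<omega>) + control f m0 q0 t (Y \<omega>) = c (Y \<omega>) (\<theta> \<omega>)"
      by (simp add: control_def c_def algebra_simps)
    also have "\<dots> = c (Z \<omega>) (\<theta> \<omega>)" by (rule c_cong) (simp add: Z \<omega>)
    finally have "y (Suc t) \<omega> = c (Z \<omega>) (\<theta> \<omega>) + w (Suc t) \<omega>" .
    then show "g (Y \<omega>, \<theta> \<omega>) = g ((Z \<omega>)(Suc t := c (Z \<omega>) (\<theta> \<omega>) + w (Suc t) \<omega>), \<theta> \<omega>)"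
      by (intro adaptedD[OF ad]) (auto simp: le_Suc_eq Z \<omega>)
  qed
  also have "\<dots> = (\<integral>\<^sup>+\<omega>. \<integral>\<^sup>+b. ennreal (normal_density 0 1 b)
      * g ((Z \<omega>)(Suc t := c (Z \<omega>) (\<theta> \<omega>) + b), \<theta> \<omega>) \<partial>lborel \<partial>M)"
    using nn_integral_noise[OF g1] by (simp add: Z_def)
  also have "\<dots> = (\<integral>\<^sup>+\<omega>. k (Z \<omega>, \<theta> \<omega>) \<partial>M)"
  proof (rule nn_integral_cong)
    fix \<omega>
    have gm: "(\<lambda>b. g ((Z \<omega>)(Suc t := b), \<theta> \<omega>)) \<in> borel_measurable borel"
      by measurable (auto simp: space_PiM)
    show "(\<integral>\<^sup>+b. ennreal (normal_density 0 1 b) * g ((Z \<omega>)(Suc t := c (Z \<omega>) (\<theta> \<omega>) + b), \<theta> \<omega>) \<partial>lborel)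
        = k (Z \<omega>, \<theta> \<omega>)"
      using shift[OF gm, of "c (Z \<omega>) (\<theta> \<omega>)"] by (simp add: k_def mult.commute)
  qed
  also have "\<dots> = (\<integral>\<^sup>+\<omega>. k (Y \<omega>, \<theta> \<omega>) \<partial>M)"
    by (intro nn_integral_cong adaptedD[OF k_ad]) (simp add: Z)
  also have "\<dots> = (\<integral>\<^sup>+\<omega>. \<integral>\<^sup>+a. k (Y \<omega>, a) * ennreal (posterior t (Y \<omega>) a) \<partial>lborel \<partial>M)"
    using post k_meas k_ad unfolding posterior_at_def by blast
  also have "\<dots> = (\<integral>\<^sup>+\<omega>. \<integral>\<^sup>+b. (\<integral>\<^sup>+a. g ((Y \<omega>)(Suc t := b), a) * ennreal (posterior (Suc t) ((Y \<omega>)(Suc t := b)) a) \<partial>lborel)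
        \<partial>gauss (scale f (y t \<omega>) (info f q0 t (Y \<omega>))) \<partial>M)"
  proof (rule nn_integral_cong)
    fix \<omega>
    define p where "p = Y \<omega>"
    have [simp]: "p \<in> space path_space" by (simp add: space_PiM)
    define \<sigma> where "\<sigma> = scale f (p t) (info f q0 t p)"
    have q: "0 < info f q0 t p" using info_ge[of q0 f t p] q0 by linarith
    have dens: "normal_density (c p a) 1 b * posterior t p a
        = normal_density 0 \<sigma> b * posterior (Suc t) (p(Suc t := b)) a" for a b
      unfolding c_def posterior_def \<sigma>_def scale_def estimate_Suc_upd info_Suc
      using normal_density_update[OF q, of a "estimate f m0 q0 t p" "f (p t)" b] by simp
    have gm [measurable]: "(\<lambda>(b, a). g (p(Suc t := b), a)) \<in> borel_measurable (borel \<Otimes>\<^sub>M borel)"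
      by measurable
    have pm [measurable]: "(\<lambda>(b, a). posterior (Suc t) (p(Suc t := b)) a) \<in> borel_measurable (borel \<Otimes>\<^sub>M borel)"
      by measurable
    have [measurable]: "(\<lambda>b. g (p(Suc t := b), a)) \<in> borel_measurable borel" for a
      by measurable
    have "(\<integral>\<^sup>+a. k (p, a) * ennreal (posterior t p a) \<partial>lborel)
        = (\<integral>\<^sup>+a. \<integral>\<^sup>+b. g (p(Suc t := b), a) * ennreal (normal_density 0 \<sigma> b)
            * ennreal (posterior (Suc t) (p(Suc t := b)) a) \<partial>lborel \<partial>lborel)"
    proof (rule nn_integral_cong)
      fix a :: real
      have "k (p, a) * ennreal (posterior t p a)
          = (\<integral>\<^sup>+b. g (p(Suc t := b), a) * ennreal (normal_density (c p a) 1 b) * ennreal (posterior t p a) \<partial>lborel)"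
        by (simp add: k_def nn_integral_multc)
      also have "\<dots> = (\<integral>\<^sup>+b. g (p(Suc t := b), a) * ennreal (normal_density 0 \<sigma> b)
            * ennreal (posterior (Suc t) (p(Suc t := b)) a) \<partial>lborel)"
      proof (rule nn_integral_cong)
        fix b
        have "ennreal (normal_density (c p a) 1 b) * ennreal (posterior t p a)
            = ennreal (normal_density 0 \<sigma> b) * ennreal (posterior (Suc t) (p(Suc t := b)) a)"
          using dens[of a b] by (simp add: posterior_def flip: ennreal_mult)
        then show "g (p(Suc t := b), a) * ennreal (normal_density (c p a) 1 b) * ennreal (posterior t p a)
            = g (p(Suc t := b), a) * ennreal (normal_density 0 \<sigma> b) * ennreal (posterior (Suc t) (p(Suc t := b)) a)"
          by (simp add: mult.assoc)
      qed
      finally show "k (p, a) * ennreal (posterior t p a) = \<dots>" .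
    qed
    also have "\<dots> = (\<integral>\<^sup>+b. \<integral>\<^sup>+a. g (p(Suc t := b), a) * ennreal (normal_density 0 \<sigma> b)
            * ennreal (posterior (Suc t) (p(Suc t := b)) a) \<partial>lborel \<partial>lborel)"
      by (rule lborel_pair.Fubini') measurable
    also have "\<dots> = (\<integral>\<^sup>+b. ennreal (normal_density 0 \<sigma> b) * (\<integral>\<^sup>+a. g (p(Suc t := b), a)
            * ennreal (posterior (Suc t) (p(Suc t := b)) a) \<partial>lborel) \<partial>lborel)"
      by (intro nn_integral_cong) (simp add: nn_integral_cmult[symmetric] mult_ac)
    also have "\<dots> = (\<integral>\<^sup>+b. (\<integral>\<^sup>+a. g (p(Suc t := b), a)
            * ennreal (posterior (Suc t) (p(Suc t := b)) a) \<partial>lborel) \<partial>gauss \<sigma>)"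
      by (rule nn_integral_gauss[symmetric]) measurable
    finally show "(\<integral>\<^sup>+a. k (Y \<omega>, a) * ennreal (posterior t (Y \<omega>) a) \<partial>lborel)
        = (\<integral>\<^sup>+b. (\<integral>\<^sup>+a. g ((Y \<omega>)(Suc t := b), a) * ennreal (posterior (Suc t) ((Y \<omega>)(Suc t := b)) a) \<partial>lborel)
            \<partial>gauss (scale f (y t \<omega>) (info f q0 t (Y \<omega>))))"
      by (simp add: p_def \<sigma>_def)
  qed
  finally show ?thesis .
qed

lemma nn_integral_posterior: "(\<integral>\<^sup>+a. ennreal (posterior t p a) \<partial>lborel) = 1"
proof -
  have "0 < info f q0 t p" using info_ge[of q0 f t p] q0 by linarith
  then interpret N: prob_space "density lborel (posterior t p)"
    unfolding posterior_def by (intro prob_space_normal_density) simp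
  show ?thesis
    using N.emeasure_space_1 by (simp add: emeasure_density posterior_def)
qed

text \<open>A function of the path alone comes out of the posterior integral, which is 1; what
  remains is the Gaussian transition.\<close>

lemma predict_path:
  assumes post: "posterior_at t" and h [measurable]: "h \<in> borel_measurable path_space"
    and ad: "adapted (Suc t) h"
  shows "(\<integral>\<^sup>+\<omega>. h (Y \<omega>) \<partial>M)
    = (\<integral>\<^sup>+\<omega>. \<integral>\<^sup>+b. h ((Y \<omega>)(Suc t := b)) \<partial>gauss (scale f (y t \<omega>) (info f q0 t (Y \<omega>))) \<partial>M)"
proof -
  have "(\<integral>\<^sup>+a. h p * ennreal (posterior (Suc t) p a) \<partial>lborel) = h p" for p
  proof -
    have "(\<integral>\<^sup>+a. h p * ennreal (posterior (Suc t) p a) \<partial>lborel)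
        = h p * (\<integral>\<^sup>+a. ennreal (posterior (Suc t) p a) \<partial>lborel)"
      by (rule nn_integral_cmult) (simp add: posterior_def)
    then show ?thesis by (simp only: nn_integral_posterior mult_1_right)
  qed
  note int = this
  have meas: "(\<lambda>x. h (fst x)) \<in> borel_measurable (path_space \<Otimes>\<^sub>M borel)" by measurable
  have "adapted (Suc t) (\<lambda>p. h (fst (p, a)))" for a :: real
    using ad by simp
  from predict[OF post meas this] show ?thesis unfolding fst_conv int .
qed

text \<open>Initially the posterior is the prior, by independence of \<open>y 0\<close> and the
  parameter. In the induction step, a test function and its average over the new posterior have the
  same transition formula, by \<open>predict\<close> and \<open>predict_path\<close>.\<close>

lemma posterior_at_all: "posterior_at t"
proof (induction t)
  case 0
  show ?case unfolding posterior_at_def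
  proof (intro allI impI)
    fix g :: "(nat \<Rightarrow> real) \<times> real \<Rightarrow> ennreal"
    assume g [measurable]: "g \<in> borel_measurable (path_space \<Otimes>\<^sub>M borel)"
      and ad: "\<forall>a. adapted 0 (\<lambda>p. g (p, a))"
    have "indep_var (PiM {0} (\<lambda>_. borel)) (\<lambda>\<omega>. restrict (\<lambda>n. X n \<omega>) {0})
        (PiM {1} (\<lambda>_. borel)) (\<lambda>\<omega>. restrict (\<lambda>n. X n \<omega>) {1})"
      by (rule indep_var_restrict[OF indep]) auto
    then have "indep_var borel ((\<lambda>x. x 0) \<circ> (\<lambda>\<omega>. restrict (\<lambda>n. X n \<omega>) {0}))
        borel ((\<lambda>x. x 1) \<circ> (\<lambda>\<omega>. restrict (\<lambda>n. X n \<omega>) {1}))"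
      by (rule indep_var_compose) (auto intro!: measurable_component_singleton)
    also have "(\<lambda>x. x 0) \<circ> (\<lambda>\<omega>. restrict (\<lambda>n. X n \<omega>) {0}) = y 0" by (auto simp: X_def)
    also have "(\<lambda>x. x 1) \<circ> (\<lambda>\<omega>. restrict (\<lambda>n. X n \<omega>) {1}) = \<theta>" by (auto simp: X_def)
    finally have ind: "indep_var borel (y 0) borel \<theta>" .
    have gY: "g (Y \<omega>, a) = g (\<lambda>_. y 0 \<omega>, a)" for \<omega> a
      by (rule adaptedD[OF ad[rule_format]]) simp
    have "(\<lambda>x. (\<lambda>_. fst x, snd x)) \<in> measurable (borel \<Otimes>\<^sub>M borel) (path_space \<Otimes>\<^sub>M borel)"
      by (intro measurable_Pair measurable_PiM_single' measurable_fst measurable_snd)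
         (auto simp: space_PiM)
    from measurable_compose[OF this g]
    have g': "(\<lambda>x. g (\<lambda>_. fst x, snd x)) \<in> borel_measurable (borel \<Otimes>\<^sub>M borel)" .
    have "(\<integral>\<^sup>+\<omega>. g (Y \<omega>, \<theta> \<omega>) \<partial>M) = (\<integral>\<^sup>+\<omega>. \<integral>\<^sup>+\<omega>'. g (\<lambda>_. y 0 \<omega>, \<theta> \<omega>') \<partial>M \<partial>M)"
      using nn_integral_indep_var[OF ind g'] by (simp add: gY)
    also have "\<dots> = (\<integral>\<^sup>+\<omega>. \<integral>\<^sup>+a. g (Y \<omega>, a) * ennreal (posterior 0 (Y \<omega>) a) \<partial>lborel \<partial>M)"
    proof (rule nn_integral_cong)
      fix \<omega>
      have "(\<lambda>a. g (\<lambda>_. y 0 \<omega>, a)) \<in> borel_measurable borel"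
        by (rule measurable_Pair2[OF g]) (auto simp: space_PiM)
      then have "(\<integral>\<^sup>+\<omega>'. g (\<lambda>_. y 0 \<omega>, \<theta> \<omega>') \<partial>M)
          = (\<integral>\<^sup>+a. ennreal (normal_density m0 (1 / sqrt q0) a) * g (\<lambda>_. y 0 \<omega>, a) \<partial>lborel)"
        by (intro distributed_nn_integral[OF \<theta>_normal, symmetric]) auto
      then show "(\<integral>\<^sup>+\<omega>'. g (\<lambda>_. y 0 \<omega>, \<theta> \<omega>') \<partial>M)
          = (\<integral>\<^sup>+a. g (Y \<omega>, a) * ennreal (posterior 0 (Y \<omega>) a) \<partial>lborel)"
        by (simp add: gY posterior_def estimate_def info_def mult.commute)
    qed
    finally show "(\<integral>\<^sup>+\<omega>. g (Y \<omega>, \<theta> \<omega>) \<partial>M)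
        = (\<integral>\<^sup>+\<omega>. \<integral>\<^sup>+a. g (Y \<omega>, a) * ennreal (posterior 0 (Y \<omega>) a) \<partial>lborel \<partial>M)" .
  qed
next
  case (Suc t)
  show ?case unfolding posterior_at_def
  proof (intro allI impI)
    fix g :: "(nat \<Rightarrow> real) \<times> real \<Rightarrow> ennreal"
    assume g [measurable]: "g \<in> borel_measurable (path_space \<Otimes>\<^sub>M borel)"
      and ad: "\<forall>a. adapted (Suc t) (\<lambda>p. g (p, a))"
    define h where "h p = (\<integral>\<^sup>+a. g (p, a) * ennreal (posterior (Suc t) p a) \<partial>lborel)" for p
    have h: "h \<in> borel_measurable path_space"
      unfolding h_def[abs_def] by measurable
    have "adapted (Suc t) h"
      unfolding adapted_def
    proof (intro allI impI)
      fix p p' :: "nat \<Rightarrow> real" assume eq: "\<forall>i\<le>Suc t. p i = p' i"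
      have "g (p, a) = g (p', a)" for a
        by (rule adaptedD[OF ad[rule_format]]) (use eq in auto)
      moreover have "posterior (Suc t) p = posterior (Suc t) p'"
        unfolding posterior_def
        using eq estimate_cong[of "Suc t" p p'] info_cong[of "Suc t" p p'] by simp
      ultimately show "h p = h p'" by (simp add: h_def)
    qed
    then have "(\<integral>\<^sup>+\<omega>. h (Y \<omega>) \<partial>M)
        = (\<integral>\<^sup>+\<omega>. \<integral>\<^sup>+b. h ((Y \<omega>)(Suc t := b)) \<partial>gauss (scale f (y t \<omega>) (info f q0 t (Y \<omega>))) \<partial>M)"
      by (rule predict_path[OF Suc h])
    moreover have "(\<integral>\<^sup>+\<omega>. g (Y \<omega>, \<theta> \<omega>) \<partial>M)
        = (\<integral>\<^sup>+\<omega>. \<integral>\<^sup>+b. h ((Y \<omega>)(Suc t := b)) \<partial>gauss (scale f (y t \<omega>) (info f q0 t (Y \<omega>))) \<partial>M)"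
      unfolding h_def by (rule predict[OF Suc g]) (use ad in blast)
    ultimately show "(\<integral>\<^sup>+\<omega>. g (Y \<omega>, \<theta> \<omega>) \<partial>M)
        = (\<integral>\<^sup>+\<omega>. \<integral>\<^sup>+a. g (Y \<omega>, a) * ennreal (posterior (Suc t) (Y \<omega>) a) \<partial>lborel \<partial>M)"
      by (simp add: h_def)
  qed
qed

lemma gaussian_path_distr: "gaussian_path (distr M path_space Y) f q0"
proof -
  show ?thesis
  proof (intro gaussian_path.intro gaussian_path_axioms.intro)
    show "prob_space (distr M path_space Y)" by (rule prob_space_distr) measurable
    fix t and g :: "(nat \<Rightarrow> real) \<Rightarrow> ennreal"
    assume g [measurable]: "g \<in> borel_measurable path_space" and ad: "adapted (Suc t) g"
    \<comment> \<open>The law \<open>gauss\<close> varies with the path; a Lebesgue integral with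
      explicit density makes measurability in the path evident.\<close>
    define k where "k p = (\<integral>\<^sup>+b. ennreal (normal_density 0 (scale f (p t) (info f q0 t p)) b)
      * g (p(Suc t := b)) \<partial>lborel)" for p
    have k: "k p = (\<integral>\<^sup>+b. g (p(Suc t := b)) \<partial>gauss (scale f (p t) (info f q0 t p)))" for p
      unfolding k_def by (rule nn_integral_gauss[symmetric], measurable) (auto simp: space_PiM)
    have [measurable]: "k \<in> borel_measurable path_space"
      unfolding k_def[abs_def] normal_density_def scale_def by measurable
    have "(\<integral>\<^sup>+p. g p \<partial>distr M path_space Y) = (\<integral>\<^sup>+\<omega>. g (Y \<omega>) \<partial>M)"
      by (simp add: nn_integral_distr)
    also have "\<dots> = (\<integral>\<^sup>+\<omega>. k (Y \<omega>) \<partial>M)"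
      unfolding k by (rule predict_path[OF posterior_at_all g ad])
    also have "\<dots> = (\<integral>\<^sup>+p. k p \<partial>distr M path_space Y)"
      by (simp add: nn_integral_distr)
    finally show "(\<integral>\<^sup>+p. g p \<partial>distr M path_space Y)
        = (\<integral>\<^sup>+p. \<integral>\<^sup>+b. g (p(Suc t := b)) \<partial>gauss (scale f (p t) (info f q0 t p)) \<partial>distr M path_space Y)"
      by (simp add: k)
  qed (simp_all add: q0 f_meas)
qed

end

section \<open>Closing the loop\<close>

lemma generated_vimage: "X \<in> Xs \<Longrightarrow> B \<in> sets borel \<Longrightarrow> X -` B \<inter> \<Omega> \<in> sets (generated \<Omega> Xs)"
  unfolding sets_generated by (rule sigma_sets.Basic) blast

text \<open>The hypotheses are nested: the initial value is independent of parameter and noise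
  jointly, the parameter of the noise, and the noise variables of one another. Probabilities of
  finite intersections factor in this order.\<close>

lemma (in prob_space) indep_vars_initial_parameter_noise:
  assumes \<theta> [measurable]: "\<theta> \<in> borel_measurable M"
    and w: "indep_vars (\<lambda>_. borel) w {1..}"
    and \<theta>w: "indep_set (sets (generated (space M) {\<theta>})) (sets (generated (space M) (w ` {1..})))"
    and y0: "admissible_initial M \<theta> w y0"
  shows "indep_vars (\<lambda>_. borel) (\<lambda>n. if n = 0 then y0 else if n = 1 then \<theta> else w (n - 1)) UNIV"
proof -
  define X where "X = (\<lambda>n. if n = 0 then y0 else if n = (1::nat) then \<theta> else w (n - 1))"
  have X0: "X 0 = y0" and X1: "X (Suc 0) = \<theta>" and X2: "X (Suc (Suc i)) = w (Suc i)" for i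
    by (auto simp: X_def)
  have X_meas [measurable]: "X n \<in> borel_measurable M" for n
    using y0 w by (auto simp: X_def admissible_initial_def indep_vars_def)
  have "indep_sets (\<lambda>n. {X n -` B \<inter> space M | B. B \<in> sets borel}) UNIV"
  proof (rule indep_setsI)
    fix A :: "nat \<Rightarrow> 'a set" and J :: "nat set"
    assume J: "finite J" and A: "\<forall>j\<in>J. A j \<in> {X j -` B \<inter> space M | B. B \<in> sets borel}"
    \<comment> \<open>Missing coordinates are filled with the whole space, so a nonempty finite
      index set can be enlarged to an initial segment without changing the intersection or the
      product.\<close>
    define E where "E j = (if j \<in> J then A j else space M)" for j
    have "\<exists>B. B \<in> sets borel \<and> E j = X j -` B \<inter> space M" for j
      using A by (cases "j \<in> J") (auto simp: E_def intro: exI[of _ UNIV])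
    then obtain B where B: "\<And>j. B j \<in> sets borel" and E: "\<And>j. E j = X j -` B j \<inter> space M"
      by metis
    obtain N where "J \<subseteq> {..N}" using J finite_nat_iff_bounded_le by blast
    define K where "K = insert 0 (insert (Suc 0) ((\<lambda>i. Suc (Suc i)) ` {..N}))"
    have JK: "J \<subseteq> K"
    proof
      fix j assume "j \<in> J"
      then have "j \<le> N" using \<open>J \<subseteq> {..N}\<close> by auto
      show "j \<in> K"
      proof (cases "j < 2")
        case False
        then have "j = Suc (Suc (j - 2))" "j - 2 \<in> {..N}" using \<open>j \<le> N\<close> by auto
        then have "j \<in> (\<lambda>i. Suc (Suc i)) ` {..N}" by (rule image_eqI)
        then show ?thesis by (simp add: K_def)
      qed (auto simp: K_def less_2_cases_iff)
    qed
    define V where "V = (\<Inter>i\<le>N. E (Suc (Suc i)))"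
    have gen_w: "E (Suc (Suc i)) \<in> sets (generated (space M) (w ` {1..}))"
      "E (Suc (Suc i)) \<in> sets (generated (space M) (insert \<theta> (w ` {1..})))" for i
      unfolding E X2 by (intro generated_vimage B; simp)+
    have V: "V \<in> sets (generated (space M) (w ` {1..}))"
      "V \<in> sets (generated (space M) (insert \<theta> (w ` {1..})))"
      unfolding V_def using gen_w by (auto intro!: sets.finite_INT)
    have E1: "E (Suc 0) \<in> sets (generated (space M) {\<theta>})"
      "E (Suc 0) \<in> sets (generated (space M) (insert \<theta> (w ` {1..})))"
      unfolding E X1 by (intro generated_vimage B; simp)+
    have E0: "E 0 \<in> sets (generated (space M) {y0})"
      unfolding E X0 by (intro generated_vimage B; simp)
    have "prob V = prob (\<Inter>i\<in>Suc ` {..N}. w i -` B (Suc i) \<inter> space M)"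
      by (auto simp: V_def E X2 intro!: arg_cong[where f=prob])
    also have "\<dots> = (\<Prod>i\<in>Suc ` {..N}. prob (w i -` B (Suc i) \<inter> space M))"
      by (rule indep_varsD[OF w]) (auto simp: B)
    also have "\<dots> = (\<Prod>i\<le>N. prob (E (Suc (Suc i))))"
      by (subst prod.reindex) (auto simp: E X2)
    finally have pV: "prob V = (\<Prod>i\<le>N. prob (E (Suc (Suc i))))" .
    have "(\<Inter>j\<in>J. A j) = (\<Inter>j\<in>K. E j)" if ne: "J \<noteq> {}"
    proof -
      obtain j0 where j0: "j0 \<in> J" using ne by blast
      then have A0: "A j0 \<subseteq> space M" using A by auto
      show ?thesis
      proof (intro equalityI subsetI INT_I)
        fix x j assume "x \<in> (\<Inter>j\<in>J. A j)" "j \<in> K"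
        then show "x \<in> E j" using j0 A0 by (auto simp: E_def)
      next
        fix x j assume x: "x \<in> (\<Inter>j\<in>K. E j)" and j: "j \<in> J"
        then have "x \<in> E j" using JK by blast
        then show "x \<in> A j" using j by (simp add: E_def)
      qed
    qed
    moreover have "(\<Inter>j\<in>K. E j) = E 0 \<inter> (E (Suc 0) \<inter> V)"
      by (auto simp: K_def V_def)
    moreover have "prob (E 0 \<inter> (E (Suc 0) \<inter> V)) = prob (E 0) * prob (E (Suc 0) \<inter> V)"
      using y0 E0 E1(2) V(2) unfolding admissible_initial_def by (intro indep_setD) auto
    moreover have "prob (E (Suc 0) \<inter> V) = prob (E (Suc 0)) * prob V"
      using indep_setD[OF \<theta>w E1(1) V(1)] .
    moreover have "(\<Prod>j\<in>K. prob (E j)) = prob (E 0) * (prob (E (Suc 0)) * (\<Prod>i\<le>N. prob (E (Suc (Suc i)))))"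
      unfolding K_def by (simp add: prod.reindex inj_on_def image_iff)
    moreover have "(\<Prod>j\<in>J. prob (A j)) = (\<Prod>j\<in>K. prob (E j))"
      by (rule prod.mono_neutral_cong_left) (use JK in \<open>auto simp: K_def E_def prob_space\<close>)
    moreover assume "J \<noteq> {}"
    ultimately show "prob (\<Inter>j\<in>J. A j) = (\<Prod>j\<in>J. prob (A j))"
      using pV by simp
  qed auto
  then show ?thesis
    unfolding X_def[symmetric] indep_vars_def2 using X_meas by simp
qed

section \<open>Piecewise continuous functions\<close>

lemma countable_discontinuities:
  assumes "piecewise_continuous f"
  shows "countable {x. \<not> isCont f x}"
proof -
  have "{x. \<not> isCont f x} = (\<Union>n::nat. {x \<in> {- real n..real n}. \<not> isCont f x})"
  proof -
    have "\<exists>n::nat. x \<in> {- real n..real n}" for x :: real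
    proof -
      obtain n :: nat where "\<bar>x\<bar> \<le> real n" using real_arch_simple by blast
      then have "x \<in> {- real n..real n}" by auto
      then show ?thesis by blast
    qed
    then show ?thesis by blast
  qed
  moreover have "countable {x \<in> {- real n..real n}. \<not> isCont f x}" for n
    using assms unfolding piecewise_continuous_def by (intro countable_finite) blast
  ultimately show ?thesis by (simp only:) (rule countable_UN, auto)
qed

lemma piecewise_continuous_measurable:
  assumes "piecewise_continuous f"
  shows "f \<in> borel_measurable borel"
  using countable_discontinuities[OF assms]
  by (rule borel_measurable_continuous_countable_exceptions) (auto intro: continuous_at_imp_continuous_on)

text \<open>Near a continuity point with nonzero value, \<open>|f|\<close> lies between half and
  twice its value there. If there is no such point, \<open>f\<close> is nonzero only at
  discontinuities, which are countable and hence null.\<close>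

lemma piecewise_continuous_null_or_away_from_zero:
  assumes "piecewise_continuous f"
  shows "(AE x in lborel. f x = 0) \<or>
    (\<exists>x \<delta> \<eta> H. 0 < \<delta> \<and> 0 < \<eta> \<and> (\<forall>b. \<bar>b - x\<bar> < \<delta> \<longrightarrow> \<eta> \<le> \<bar>f b\<bar> \<and> \<bar>f b\<bar> \<le> H))"
proof (cases "\<exists>x. isCont f x \<and> f x \<noteq> 0")
  case True
  then obtain x where x: "isCont f x" "f x \<noteq> 0" by blast
  then obtain \<delta> where \<delta>: "0 < \<delta>" "\<And>b. \<bar>b - x\<bar> < \<delta> \<Longrightarrow> \<bar>f b - f x\<bar> < \<bar>f x\<bar> / 2"
    unfolding continuous_at_eps_delta dist_real_def by (meson half_gt_zero zero_less_abs_iff)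
  have "\<bar>f x\<bar> / 2 \<le> \<bar>f b\<bar> \<and> \<bar>f b\<bar> \<le> 2 * \<bar>f x\<bar>" if "\<bar>b - x\<bar> < \<delta>" for b
    using \<delta>(2)[OF that] by linarith
  moreover have "0 < \<bar>f x\<bar> / 2" using x(2) by simp
  ultimately show ?thesis using \<delta>(1) by blast
next
  case False
  then have "{x. f x \<noteq> 0} \<subseteq> {x. \<not> isCont f x}" by auto
  then have "{x. f x \<noteq> 0} \<in> null_sets lborel"
    using countable_discontinuities[OF assms] countable_subset countable_imp_null_set_lborel by blast
  then have "AE x in lborel. f x = 0"
    by (rule AE_I') auto
  then show ?thesis ..
qed

lemma bounded_average_SUP:
  assumes "p \<in> bounded_average"
  shows "(SUP t\<in>{1..}. ereal (1 / real t * (\<Sum>i=1..t. (p i)\<^sup>2))) < \<infinity>"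
proof -
  obtain K where K: "\<And>t. 1 \<le> t \<Longrightarrow> (\<Sum>i=1..t. (p i)\<^sup>2) \<le> K * real t"
    using assms unfolding bounded_average_def by blast
  have "(SUP t\<in>{1..}. ereal (1 / real t * (\<Sum>i=1..t. (p i)\<^sup>2))) \<le> ereal K"
  proof (rule SUP_least)
    fix t :: nat assume "t \<in> {1..}"
    then show "ereal (1 / real t * (\<Sum>i=1..t. (p i)\<^sup>2)) \<le> ereal K"
      using K[of t] by (simp add: field_simps)
  qed
  also have "\<dots> < \<infinity>" by simp
  finally show ?thesis .
qed

theorem theorem2p2:
  fixes M :: "'a measure"
    and f :: "real \<Rightarrow> real"
    and \<theta> :: "'a \<Rightarrow> real"
    and w :: "nat \<Rightarrow> 'a \<Rightarrow> real"
    and \<theta>\<^sub>0 P\<^sub>0 :: real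
  assumes "prob_space M"
    and "piecewise_continuous f"
    and "prob_space.indep_vars M (\<lambda>_. borel) w {1..}"
    and "\<forall>t\<ge>1. distr M borel (w t) = distr M borel (w 1)"
    and "distributed M lborel (w 1) (normal_density 0 1)"
    and "P\<^sub>0 > 0"
    and "distributed M lborel \<theta> (normal_density \<theta>\<^sub>0 (sqrt P\<^sub>0))"
    and "prob_space.indep_set M (sets (generated (space M) {\<theta>}))
           (sets (generated (space M) (w ` {1..})))"
    and "\<exists>k\<^sub>1>0. \<exists>k\<^sub>2>0. \<forall>x. \<bar>f x\<bar> \<le> k\<^sub>1 * exp (k\<^sub>2 * \<bar>x\<bar>)"
    and "\<exists>b L. b < 4 \<and> L > 0 \<and>
           Liminf at_top (\<lambda>l::real. ereal (measure lebesgue (growth_set f b L \<inter> {-l..l}) / l)) > 0"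
  shows "globally_stabilizable M f \<theta> w"
proof -
  interpret prob_space M by fact
  define q0 where "q0 = 1 / P\<^sub>0"
  have q0: "0 < q0" "1 / sqrt q0 = sqrt P\<^sub>0"
    using \<open>P\<^sub>0 > 0\<close> by (auto simp: q0_def real_sqrt_divide)
  have f: "f \<in> borel_measurable borel"
    by (rule piecewise_continuous_measurable) fact
  obtain k1 k2 where k1: "0 < k1" and bound: "\<And>x. \<bar>f x\<bar> \<le> k1 * exp (k2 * \<bar>x\<bar>)"
    using assms(9) by blast
  obtain b L where b: "b < 4" and L: "0 < L"
    and dens: "Liminf at_top (\<lambda>l::real. ereal (measure lebesgue (growth_set f b L \<inter> {-l..l}) / l)) > 0"
    using assms(10) by blast
  have \<theta>_meas: "\<theta> \<in> borel_measurable M"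
    using distributed_measurable[OF assms(7)] by simp
  \<comment> \<open>Identical distribution transfers the density of \<open>w 1\<close>; the passage
    between \<open>borel\<close> and \<open>lborel\<close> as target is harmless because their
    measurable sets coincide.\<close>
  have w_normal: "distributed M lborel (w t) (normal_density 0 1)" if "1 \<le> t" for t
  proof -
    have "w t \<in> borel_measurable M" using assms(3) that by (auto simp: indep_vars_def)
    moreover have "distr M lborel (w t) = distr M lborel (w 1)"
    proof -
      have "distr M lborel (w s) = distr M borel (w s)" for s by (rule distr_cong) auto
      then show ?thesis using assms(4) that by metis
    qed
    ultimately show ?thesis using assms(5) by (simp add: distributed_def)
  qed
  show ?thesis
    unfolding globally_stabilizable_def
  proof (intro exI[of _ "control f \<theta>\<^sub>0 q0"] conjI allI impI)
    show "feedback_law (control f \<theta>\<^sub>0 q0)" by (rule feedback_law_control[OF f])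
    fix y assume y0: "admissible_initial M \<theta> w (y 0)" and loop: "closed_loop M f \<theta> w (control f \<theta>\<^sub>0 q0) y"
    interpret S: self_tuning M f \<theta> w y \<theta>\<^sub>0 q0 "\<lambda>n. if n = 0 then y 0 else if n = 1 then \<theta> else w (n - 1)"
    proof unfold_locales
      show "distributed M lborel \<theta> (normal_density \<theta>\<^sub>0 (1 / sqrt q0))" using assms(7) q0(2) by simp
      show "indep_vars (\<lambda>_. borel) (\<lambda>n. if n = 0 then y 0 else if n = 1 then \<theta> else w (n - 1)) UNIV"
        by (rule indep_vars_initial_parameter_noise[OF \<theta>_meas assms(3) assms(8) y0])
    qed (use f q0 w_normal loop in auto)
    define D where "D = distr M path_space (\<lambda>\<omega> i. y i \<omega>)"
    interpret D: gaussian_path D f q0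
      unfolding D_def by (rule S.gaussian_path_distr)
    have "D.good {(y, q). q0 \<le> q}"
    proof (cases "AE x in lborel. f x = 0")
      case True
      then show ?thesis by (rule D.good_null)
    next
      case False
      then obtain x \<delta> \<eta> H where x: "0 < \<delta>" "0 < \<eta>"
        "\<And>b. \<bar>b - x\<bar> < \<delta> \<Longrightarrow> \<eta> \<le> \<bar>f b\<bar> \<and> \<bar>f b\<bar> \<le> H"
        using piecewise_continuous_null_or_away_from_zero[OF assms(2)] by blast
      interpret E: excited_gaussian_path D f q0 k1 k2 x \<delta> \<eta> H
        by unfold_locales (use bound k1 x in auto)
      \<comment> \<open>Raising the exponent to \<open>max b 1\<close> makes it positive, as
        \<open>good_all\<close> requires, and keeps it below 4.\<close>
      obtain r R0 where "0 < r" "\<And>\<sigma>. R0 \<le> \<sigma> \<Longrightarrow> r \<le> measure (gauss \<sigma>)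
          {x. 1 \<le> \<bar>x\<bar> \<and> \<bar>x\<bar> \<le> \<sigma> \<and> \<bar>f x\<bar> < L * \<bar>x\<bar> powr max b 1}"
        using gauss_growth_set_ge[OF f L max.cobounded1 dens] by blast
      then show ?thesis
        by (rule E.good_all) (use b L in auto)
    qed
    then have "AE p in D. p \<in> bounded_average" by (rule D.AE_bounded_average)
    then have "AE \<omega> in M. (\<lambda>i. y i \<omega>) \<in> bounded_average"
      unfolding D_def by (rule AE_distrD[OF S.Y_measurable])
    then show "AE \<omega> in M. (SUP t\<in>{1..}. ereal (1 / real t * (\<Sum>i=1..t. (y i \<omega>)\<^sup>2))) < \<infinity>"
      by eventually_elim (rule bounded_average_SUP)
  qed
qed

end
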